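(* Let $d\ge 2$ be an integer and let $(c_j)_{j\ge 0}$ be a sequence of integers such that the power series $f(z)=\sum_{j\ge 0}c_jz^j$ converges inside the open unit disk. Suppose there exist polynomials $A(z),B(z),C(z)\in\mathbb{Z}[z]$, with $B\neq 0$, such that $$f(z)=\frac{A(z)}{B(z)}+C(z)f(z^d).$$ Let $b\ge 2$ be an integer such that $C(1/b^{d^m})\neq 0$ for all integers $m\ge 0$. If there exists an increasing sequence of positive integers $(n_i)_{i\ge 0}$ such that $H_{n_i}(f)\neq 0$ for all $i\ge 0$ and $\lim_{i\to\infty} n_{i+1}/n_i=1$, then $f(1/b)$ is transcendental and its irrationality exponent $\mu(f(1/b))$ is equal to $2$.
   Context: For a power series $f(z)=\sum_{j\ge0}c_jz^j$, its Hankel determinants are $H_0(f)=1$ and, for $n\ge1$, $H_n(f)=\det(c_{i+j})_{0\le i,j\le n-1}$. The irrationality exponent $\mu(\xi)$ of an irrational real number $\xi$ is the supremum of the real numbers $\mu$ such that $|\xi-p/q|<q^{-\mu}$ has infinitely many solutions in rational numbers $p/q$. *)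

theory Defs
  imports Complex_Main "HOL-Computational_Algebra.Polynomial" "HOL-Library.Extended_Real" "Jordan_Normal_Form.Determinant"
begin

definition hankel_det :: "(nat \<Rightarrow> int) \<Rightarrow> nat \<Rightarrow> int" where
  "hankel_det c n = det (mat n n (\<lambda>(i, j). c (i + j)))"

definition irrationality_exponent :: "real \<Rightarrow> ereal" where
  "irrationality_exponent \<xi> =
     Sup {ereal \<mu> | \<mu>. infinite {(p::int, q::int). q > 0 \<and>
            \<bar>\<xi> - real_of_int p / real_of_int q\<bar> < real_of_int q powr (- \<mu>)}}"

end

(*
Iterating the functional equation expresses f(1/b^(d^m)) as a rational affine function of f(1/b)
with coefficients whose numerators and denominators are at most b^(O(d^m)).

Irrationality exponent: H_n(f) ~= 0 yields a Pade approximant P/Q with deg Q <= n, and the next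
non-vanishing H_n' bounds the order of Q f - P by n + n'. Evaluating at 1/b^(d^m) gives rational
approximations of f(1/b) of height about b^(n d^m) and of quality exponent about 2. As
n_(i+1)/n_i -> 1, the numbers n_i d^m are multiplicatively dense, which forces the exponent 2.

Transcendence: an algebraic relation for f would make a polynomial multiple of f bounded on the
disk, and by Parseval's identity a bounded power series with integer coefficients is a polynomial,
contradicting the non-vanishing Hankel determinants. Mahler's method then applies: an auxiliary
polynomial in z and f(z) of degree p vanishing to order p^2 at 0 takes values at 1/b^(d^m) that
are too small for Liouville's inequality if f(1/b) is algebraic.
*)
theory Submission
  imports Defs "HOL-Analysis.FPS_Convergence" "HOL-Analysis.Kronecker_Approximation_Theorem"
begin

section \<open>Small integer solutions of linear systems\<close>

text \<open>Nothing forbids \<open>B\<close> to vanish at a point 1/b^(d^m); there the equation,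
  multiplied out, carries no information on f and the iteration would break. Hence \<open>B\<close>
  is first replaced by a denominator of minimal degree, which has no zero at any 1/N with N >= 2.
  The rest depends on the order in which constants are chosen. The height exponent \<open>G\<close>
  of the iteration depends neither on m nor on n, so it is negligible against n_i for large i. The
  constants of a Pade approximant do depend on i, so only finitely many i may be used at once; a
  window in which n_i grows by a factor d is enough, because the powers d^m supply all larger
  scales. In the transcendence proof the auxiliary polynomial is fixed before m, so the size of its
  coefficients is irrelevant and counting unknowns replaces Siegel's lemma. Liouville's exponent,
  however, has to be independent of p, because p times that exponent competes with p^2.
  Irrationality, which the lower bound 2 requires, is then a consequence of transcendence.\<close>

lemma int_mult_abs_mono:
  fixes x y X Y :: int
  assumes "\<bar>x\<bar> \<le> X" "\<bar>y\<bar> \<le> Y"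
  shows "\<bar>x * y\<bar> \<le> X * Y"
  using assms by (simp add: abs_mult mult_mono)

text \<open>Fraction-free Gaussian elimination, one equation at a time. The order of quantifiers is
  the point: \<open>K\<close> and \<open>\<kappa>\<close> depend only on the shape \<open>m\<close>,
  \<open>s\<close> of the system, so the solution is polynomially bounded in the entries. This later
  gives a Liouville exponent that depends only on the degree of the algebraic number.\<close>

lemma bounded_kernel_vector:
  "\<exists>K::int. \<exists>\<kappa>::nat. K \<ge> 1 \<and> (\<forall>(a::nat \<Rightarrow> 'i \<Rightarrow> int) I H. finite I \<longrightarrow> card I = s \<longrightarrow> m < s \<longrightarrow> H \<ge> 1 \<longrightarrow>
      (\<forall>e<m. \<forall>i\<in>I. \<bar>a e i\<bar> \<le> H) \<longrightarrow>
      (\<exists>x. (\<exists>i\<in>I. x i \<noteq> 0) \<and> (\<forall>i\<in>I. \<bar>x i\<bar> \<le> K * H ^ \<kappa>) \<and> (\<forall>e<m. (\<Sum>i\<in>I. a e i * x i) = 0)))"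
proof (induction m arbitrary: s)
  case 0
  show ?case
  proof (rule exI[of _ 1], rule exI[of _ 0], intro conjI allI impI)
    fix a :: "nat \<Rightarrow> 'i \<Rightarrow> int" and I :: "'i set" and H :: int
    assume "finite I" "card I = s" "0 < s"
    then have "I \<noteq> {}" by auto
    then show "\<exists>x. (\<exists>i\<in>I. x i \<noteq> 0) \<and> (\<forall>i\<in>I. \<bar>x i\<bar> \<le> 1 * H ^ 0) \<and> (\<forall>e<0. (\<Sum>i\<in>I. a e i * x i) = 0)"
      by (intro exI[of _ "\<lambda>_. 1"]) auto
  qed simp
next
  case (Suc m)
  obtain K1 :: int and \<kappa>1 where 1: "K1 \<ge> 1 \<and> (\<forall>(a::nat \<Rightarrow> 'i \<Rightarrow> int) I H. finite I \<longrightarrow> card I = s \<longrightarrow> m < s \<longrightarrow> H \<ge> 1 \<longrightarrow>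
      (\<forall>e<m. \<forall>i\<in>I. \<bar>a e i\<bar> \<le> H) \<longrightarrow>
      (\<exists>x. (\<exists>i\<in>I. x i \<noteq> 0) \<and> (\<forall>i\<in>I. \<bar>x i\<bar> \<le> K1 * H ^ \<kappa>1) \<and> (\<forall>e<m. (\<Sum>i\<in>I. a e i * x i) = 0)))"
    using Suc[of s] by (elim exE) (rule that)
  note K1 = 1[THEN conjunct1] and IH1 = 1[THEN conjunct2, rule_format]
  obtain K2 :: int and \<kappa>2 where 2: "K2 \<ge> 1 \<and> (\<forall>(a::nat \<Rightarrow> 'i \<Rightarrow> int) I H. finite I \<longrightarrow> card I = (s - 1) \<longrightarrow> m < (s - 1) \<longrightarrow> H \<ge> 1 \<longrightarrow>
      (\<forall>e<m. \<forall>i\<in>I. \<bar>a e i\<bar> \<le> H) \<longrightarrow>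
      (\<exists>x. (\<exists>i\<in>I. x i \<noteq> 0) \<and> (\<forall>i\<in>I. \<bar>x i\<bar> \<le> K2 * H ^ \<kappa>2) \<and> (\<forall>e<m. (\<Sum>i\<in>I. a e i * x i) = 0)))"
    using Suc[of "s - 1"] by (elim exE) (rule that)
  note K2 = 2[THEN conjunct1] and IH2 = 2[THEN conjunct2, rule_format]
  \<comment> \<open>Sums instead of maxima, to cover both cases below. If the last equation is
    trivial, \<open>K1\<close> and \<open>\<kappa>1\<close> suffice. Otherwise the eliminated system
    has entries up to 2 H^2, which gives \<open>2 ^ \<kappa>2\<close> and
    \<open>2 * \<kappa>2\<close>, and back substitution costs one more \<open>H\<close> and at most
    \<open>s\<close> summands.\<close>
  define K where "K = K1 + int (Suc s) * K2 * 2 ^ \<kappa>2"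
  define \<kappa> where "\<kappa> = \<kappa>1 + (2 * \<kappa>2 + 1)"
  show ?case
  proof (rule exI[of _ K], rule exI[of _ \<kappa>], intro conjI allI impI)
    have "int (Suc s) * K2 * 2 ^ \<kappa>2 \<ge> 0" using K2 by simp
    then show "K \<ge> 1" using K1 unfolding K_def by linarith
    fix a :: "nat \<Rightarrow> 'i \<Rightarrow> int" and I :: "'i set" and H :: int
    assume fin: "finite I" and cI: "card I = s" and ms: "Suc m < s" and H: "H \<ge> 1"
      and "\<forall>e<Suc m. \<forall>i\<in>I. \<bar>a e i\<bar> \<le> H"
    then have aH: "\<And>e i. e < Suc m \<Longrightarrow> i \<in> I \<Longrightarrow> \<bar>a e i\<bar> \<le> H" by auto
    have pow: "H ^ i \<le> H ^ j" if "i \<le> j" for i j using H that by (simp add: power_increasing)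
    have pos: "H ^ i \<ge> 0" for i using H by simp
    show "\<exists>x. (\<exists>i\<in>I. x i \<noteq> 0) \<and> (\<forall>i\<in>I. \<bar>x i\<bar> \<le> K * H ^ \<kappa>) \<and> (\<forall>e<Suc m. (\<Sum>i\<in>I. a e i * x i) = 0)"
    proof (cases "\<forall>i\<in>I. a m i = 0")
      case True
      obtain x where x: "\<exists>i\<in>I. x i \<noteq> 0" "\<And>i. i\<in>I \<Longrightarrow> \<bar>x i\<bar> \<le> K1 * H ^ \<kappa>1" "\<forall>e<m. (\<Sum>i\<in>I. a e i * x i) = 0"
        using IH1[of I H a] fin cI ms H aH by (auto simp: less_Suc_eq)
      have "K1 * H ^ \<kappa>1 \<le> K * H ^ \<kappa>"
        using K1 K2 H pos by (intro mult_mono pow) (auto simp: K_def \<kappa>_def)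
      then show ?thesis using x True
        by (intro exI[of _ x]) (force simp: less_Suc_eq)
    next
      case False
      then obtain i0 where i0: "i0 \<in> I" "a m i0 \<noteq> 0" by auto
      define J where "J = I - {i0}"
      have J: "finite J" "card J = s - 1" "m < s - 1" "i0 \<notin> J" "I = insert i0 J" "J \<subseteq> I"
        using fin cI ms i0 by (auto simp: J_def)
      \<comment> \<open>Cross-multiplication with the pivot \<open>a m i0\<close> removes the
        unknown \<open>i0\<close> without leaving the integers; row \<open>m\<close> itself becomes
        zero.\<close>
      define a' where "a' = (\<lambda>e i. a e i * a m i0 - a e i0 * a m i)"
      have a'H: "\<forall>e<m. \<forall>i\<in>J. \<bar>a' e i\<bar> \<le> 2 * H\<^sup>2"
      proof (intro allI impI ballI)
        fix e i assume "e < m" "i \<in> J"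
        then have "\<bar>a e i * a m i0\<bar> \<le> H * H" "\<bar>a e i0 * a m i\<bar> \<le> H * H"
          using aH i0 J by (auto intro!: int_mult_abs_mono)
        then show "\<bar>a' e i\<bar> \<le> 2 * H\<^sup>2" by (simp add: a'_def power2_eq_square)
      qed
      have "2 * H\<^sup>2 \<ge> 1" using one_le_power[OF H, of 2] by linarith
      have "\<exists>x. (\<exists>i\<in>J. x i \<noteq> 0) \<and> (\<forall>i\<in>J. \<bar>x i\<bar> \<le> K2 * (2 * H\<^sup>2) ^ \<kappa>2) \<and> (\<forall>e<m. (\<Sum>i\<in>J. a' e i * x i) = 0)"
        by (rule IH2) (use J a'H \<open>2 * H\<^sup>2 \<ge> 1\<close> in auto)
      then obtain y where y: "\<exists>i\<in>J. y i \<noteq> 0" "\<And>i. i\<in>J \<Longrightarrow> \<bar>y i\<bar> \<le> K2 * (2 * H\<^sup>2) ^ \<kappa>2"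
          "\<And>e. e < m \<Longrightarrow> (\<Sum>i\<in>J. a' e i * y i) = 0" by blast
      \<comment> \<open>Back substitution: scaling \<open>y\<close> by the pivot makes the value at
        \<open>i0\<close> dictated by equation \<open>m\<close> an integer.\<close>
      define x where "x = (\<lambda>i. if i = i0 then - (\<Sum>i\<in>J. a m i * y i) else a m i0 * y i)"
      have xJ: "x i = a m i0 * y i" if "i \<in> J" for i using that J by (auto simp: x_def)
      define Y where "Y = K2 * (2 * H\<^sup>2) ^ \<kappa>2"
      have Y0: "Y \<ge> 0" using K2 by (simp add: Y_def)
      have HY: "int (Suc s) * (H * Y) \<le> K * H ^ \<kappa>"
      proof -
        have "int (Suc s) * (H * Y) = (int (Suc s) * K2 * 2 ^ \<kappa>2) * H ^ (2 * \<kappa>2 + 1)"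
          by (simp add: Y_def power_mult_distrib power_mult)
        also have "\<dots> \<le> K * H ^ \<kappa>"
          using K1 K2 H pos by (intro mult_mono pow) (auto simp: K_def \<kappa>_def)
        finally show ?thesis .
      qed
      have bound: "\<bar>x i\<bar> \<le> K * H ^ \<kappa>" if "i \<in> I" for i
      proof (cases "i = i0")
        case True
        have "\<bar>x i\<bar> \<le> (\<Sum>i\<in>J. \<bar>a m i * y i\<bar>)" using True by (simp add: x_def)
        also have "\<dots> \<le> (\<Sum>i\<in>J. H * Y)"
          using aH J y(2) by (intro sum_mono int_mult_abs_mono) (auto simp: Y_def)
        also have "\<dots> = int (s - 1) * (H * Y)" using J by simp
        also have "\<dots> \<le> int (Suc s) * (H * Y)" using H Y0 by (intro mult_right_mono) auto
        finally show ?thesis using HY by linarith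
      next
        case False
        then have iJ: "i \<in> J" using that J by auto
        have "\<bar>x i\<bar> \<le> 1 * (H * Y)" unfolding mult_1 xJ[OF iJ]
          using aH i0 y(2)[OF iJ] by (intro int_mult_abs_mono) (auto simp: Y_def)
        also have "1 * (H * Y) \<le> int (Suc s) * (H * Y)" using H Y0 by (intro mult_right_mono) auto
        finally show ?thesis using HY by linarith
      qed
      have nz: "\<exists>i\<in>I. x i \<noteq> 0" using y(1) xJ i0 J(6) by (metis mult_eq_0_iff subsetD)
      have eqs: "(\<Sum>i\<in>I. a e i * x i) = 0" if "e < Suc m" for e
      proof -
        have "(\<Sum>i\<in>I. a e i * x i) = a e i0 * x i0 + (\<Sum>i\<in>J. a e i * (a m i0 * y i))"
          using J xJ by simp
        also have "\<dots> = (\<Sum>i\<in>J. a' e i * y i)"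
          by (simp add: x_def a'_def sum_distrib_left sum_subtractf algebra_simps)
        also have "\<dots> = 0"
        proof (cases "e = m")
          case True
          then show ?thesis by (simp add: a'_def mult.commute)
        next
          case False
          then show ?thesis using y(3) that by auto
        qed
        finally show ?thesis .
      qed
      show ?thesis using nz bound eqs by blast
    qed
  qed
qed

lemma kernel_vector:
  fixes a :: "nat \<Rightarrow> 'i \<Rightarrow> int"
  assumes "finite I" "m < card I"
  obtains x where "\<exists>i\<in>I. x i \<noteq> 0" "\<And>e. e < m \<Longrightarrow> (\<Sum>i\<in>I. a e i * x i) = 0"
proof -
  define H where "H = 1 + (\<Sum>e<m. \<Sum>i\<in>I. \<bar>a e i\<bar>)"
  have le: "\<bar>a e i\<bar> \<le> H" if "e < m" "i \<in> I" for e i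
  proof -
    have "\<bar>a e i\<bar> \<le> (\<Sum>i\<in>I. \<bar>a e i\<bar>)" using that assms by (intro member_le_sum) auto
    also have "\<dots> \<le> (\<Sum>e<m. \<Sum>i\<in>I. \<bar>a e i\<bar>)"
      using that by (intro member_le_sum[where f = "\<lambda>e. \<Sum>i\<in>I. \<bar>a e i\<bar>"]) (auto intro: sum_nonneg)
    finally show ?thesis by (simp add: H_def)
  qed
  have "H \<ge> 1" by (simp add: H_def sum_nonneg)
  define s where "s = card I"
  obtain K :: int and \<kappa> where K: "K \<ge> 1 \<and> (\<forall>(a::nat \<Rightarrow> 'i \<Rightarrow> int) I H. finite I \<longrightarrow> card I = s \<longrightarrow> m < s \<longrightarrow> H \<ge> 1 \<longrightarrow>
      (\<forall>e<m. \<forall>i\<in>I. \<bar>a e i\<bar> \<le> H) \<longrightarrow>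
      (\<exists>x. (\<exists>i\<in>I. x i \<noteq> 0) \<and> (\<forall>i\<in>I. \<bar>x i\<bar> \<le> K * H ^ \<kappa>) \<and> (\<forall>e<m. (\<Sum>i\<in>I. a e i * x i) = 0)))"
    using bounded_kernel_vector[of s m] by (elim exE) (rule that)
  from K[THEN conjunct2, rule_format, of I H a] assms le s_def \<open>H \<ge> 1\<close> that show ?thesis by auto
qed

section \<open>Liouville's inequality\<close>

text \<open>The exponent is far from optimal, but it does not depend on the degree bound \<open>p\<close>,
  which is all that Mahler's method needs.\<close>

lemma liouville_inequality:
  fixes \<xi> :: real
  assumes "algebraic \<xi>"
  shows "\<exists>\<kappa>::nat. \<forall>p. \<exists>c>0. \<forall>(F::nat \<Rightarrow> int) H. H \<ge> 1 \<longrightarrow> (\<forall>l\<le>p. \<bar>F l\<bar> \<le> H) \<longrightarrow>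
     (\<Sum>l\<le>p. of_int (F l) * \<xi> ^ l) \<noteq> 0 \<longrightarrow>
     c \<le> \<bar>\<Sum>l\<le>p. of_int (F l) * \<xi> ^ l\<bar> * of_int H ^ \<kappa>"
proof -
  obtain P0 :: "int poly" where "P0 \<noteq> 0" "poly (map_poly of_int P0) \<xi> = 0"
    using algebraicE'[OF assms] by blast
  then obtain P :: "int poly" where P: "P \<noteq> 0" "poly (map_poly of_int P) \<xi> = 0"
    and min: "\<And>Q :: int poly. Q \<noteq> 0 \<Longrightarrow> poly (map_poly of_int Q) \<xi> = 0 \<Longrightarrow> degree P \<le> degree Q"
    using ex_has_least_nat[of "\<lambda>P :: int poly. P \<noteq> 0 \<and> poly (map_poly of_int P) \<xi> = 0" P0 degree] by blast
  define D where "D = degree P"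
  define a where "a = coeff P D"
  have "D \<noteq> 0"
  proof
    assume "D = 0"
    then obtain k where "P = [:k:]" using degree_eq_zeroE D_def by metis
    then show False using P by (simp add: map_poly_pCons)
  qed
  then obtain D' where D': "D = Suc D'" by (cases D) auto
  have a0: "a \<noteq> 0" using P by (simp add: a_def D_def)
  have rel: "of_int a * \<xi> ^ D = - (\<Sum>i<D. of_int (coeff P i) * \<xi> ^ i)"
  proof -
    have "0 = (\<Sum>i\<le>D. of_int (coeff P i) * \<xi> ^ i)"
      using P(2) by (simp add: poly_altdef D_def degree_map_poly coeff_map_poly)
    also have "\<dots> = (\<Sum>i<D. of_int (coeff P i) * \<xi> ^ i) + of_int a * \<xi> ^ D"
      by (simp add: a_def lessThan_Suc_atMost[symmetric])
    finally show ?thesis by simp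
  qed
  \<comment> \<open>By minimality of the degree of \<open>P\<close>, the powers 1, ...,
    \<open>\<xi> ^ (D - 1)\<close> are linearly independent over the integers.\<close>
  have indep: "(\<Sum>j<D. of_int (w j) * \<xi> ^ j) \<noteq> 0" if w: "\<exists>j<D. w j \<noteq> 0" for w :: "nat \<Rightarrow> int"
  proof
    assume z: "(\<Sum>j<D. of_int (w j) * \<xi> ^ j) = 0"
    define Q where "Q = (\<Sum>j<D. monom (w j) j)"
    have cQ: "coeff Q i = (if i < D then w i else 0)" for i
      by (simp add: Q_def coeff_sum if_distrib cong: if_cong)
    have "degree Q \<le> D'" by (rule degree_le) (simp add: cQ D')
    then have dQ: "degree Q < D" by (simp add: D')
    have "Q \<noteq> 0" using w cQ by (metis coeff_0)
    moreover have "poly (map_poly of_int Q) \<xi> = (\<Sum>i\<le>D'. of_int (coeff Q i) * \<xi> ^ i)"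
      using \<open>degree Q \<le> D'\<close>
      by (simp add: poly_altdef degree_map_poly coeff_map_poly,
          intro sum.mono_neutral_left, auto simp: coeff_eq_0)
    moreover have "\<dots> = 0"
      using z by (simp add: cQ D' lessThan_Suc_atMost)
    ultimately show False using min[of Q] dQ by (simp add: D_def)
  qed
  \<comment> \<open>The number \<open>a * \<xi>\<close> is integral: its powers have integer
    coordinates in these powers of \<open>\<xi>\<close>, by reducing with
    \<open>rel\<close>.\<close>
  have "\<exists>t::nat \<Rightarrow> int. of_int a ^ n * \<xi> ^ n = (\<Sum>i<D. of_int (t i) * \<xi> ^ i)" for n
  proof (induction n)
    case 0
    have "(\<Sum>i<D. of_int (if i = 0 then 1 else 0) * \<xi> ^ i) = 1"
      unfolding D' by (subst sum.lessThan_Suc_shift) simp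
    then show ?case by (intro exI[of _ "\<lambda>i. if i = 0 then 1 else 0"]) simp
  next
    case (Suc n)
    then obtain t :: "nat \<Rightarrow> int" where t: "of_int a ^ n * \<xi> ^ n = (\<Sum>i<D. of_int (t i) * \<xi> ^ i)" by blast
    define u where "u = (\<lambda>i. if i = 0 then 0 else a * t (i - 1))"
    have "of_int a ^ Suc n * \<xi> ^ Suc n = (of_int a * \<xi>) * (\<Sum>i<D. of_int (t i) * \<xi> ^ i)"
      using t by (simp add: algebra_simps)
    also have "\<dots> = (\<Sum>i<D'. of_int (a * t i) * \<xi> ^ Suc i) + of_int (t D') * (of_int a * \<xi> ^ D)"
      by (simp add: D' sum_distrib_left algebra_simps)
    also have "(\<Sum>i<D'. of_int (a * t i) * \<xi> ^ Suc i) = (\<Sum>i<D. of_int (u i) * \<xi> ^ i)"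
      unfolding D' by (subst sum.lessThan_Suc_shift) (simp add: u_def)
    also have "\<dots> + of_int (t D') * (of_int a * \<xi> ^ D) = (\<Sum>i<D. of_int (u i - t D' * coeff P i) * \<xi> ^ i)"
      unfolding rel by (simp add: sum_distrib_left sum_subtractf algebra_simps)
    finally show ?case by (intro exI[of _ "\<lambda>i. u i - t D' * coeff P i"])
  qed
  then obtain t :: "nat \<Rightarrow> nat \<Rightarrow> int" where t: "\<And>n. of_int a ^ n * \<xi> ^ n = (\<Sum>i<D. of_int (t n i) * \<xi> ^ i)"
    by metis
  \<comment> \<open>One equation fewer than unknowns. The shape of the system depends on
    \<open>D\<close> alone and is fixed before \<open>p\<close>, which makes \<open>\<kappa>\<close>
    independent of \<open>p\<close>.\<close>
  obtain K :: int and \<kappa> where 1: "K \<ge> 1 \<and> (\<forall>(a::nat \<Rightarrow> nat \<Rightarrow> int) I H. finite I \<longrightarrow> card I = D \<longrightarrow> D' < D \<longrightarrow> H \<ge> 1 \<longrightarrow>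
      (\<forall>e<D'. \<forall>i\<in>I. \<bar>a e i\<bar> \<le> H) \<longrightarrow>
      (\<exists>x. (\<exists>i\<in>I. x i \<noteq> 0) \<and> (\<forall>i\<in>I. \<bar>x i\<bar> \<le> K * H ^ \<kappa>) \<and> (\<forall>e<D'. (\<Sum>i\<in>I. a e i * x i) = 0)))"
    using bounded_kernel_vector[of D D'] by (elim exE) (rule that)
  note K = 1[THEN conjunct1] and ker = 1[THEN conjunct2, rule_format]
  define Z where "Z = (\<Sum>j<D. \<bar>\<xi>\<bar> ^ j)"
  have Z: "Z \<ge> 1"
  proof -
    have "Z = 1 + (\<Sum>j<D'. \<bar>\<xi>\<bar> ^ Suc j)" unfolding Z_def D' by (subst sum.lessThan_Suc_shift) simp
    then show ?thesis by (simp add: sum_nonneg)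
  qed
  show ?thesis
  proof (intro exI[of _ \<kappa>] allI)
    fix p
    define L where "L = 1 + (\<Sum>j<D. \<Sum>i<D. \<Sum>l\<le>p. \<bar>a ^ (p + D - (j + l)) * t (j + l) i\<bar>)"
    have L1: "L \<ge> 1" by (simp add: L_def sum_nonneg)
    define M where "M = \<bar>real_of_int a\<bar> ^ (p + D) * (of_int K * of_int L ^ \<kappa> * Z)"
    have M: "M > 0" using a0 K L1 Z by (simp add: M_def)
    show "\<exists>c>0. \<forall>(F::nat \<Rightarrow> int) H. H \<ge> 1 \<longrightarrow> (\<forall>l\<le>p. \<bar>F l\<bar> \<le> H) \<longrightarrow>
     (\<Sum>l\<le>p. of_int (F l) * \<xi> ^ l) \<noteq> 0 \<longrightarrow>
     c \<le> \<bar>\<Sum>l\<le>p. of_int (F l) * \<xi> ^ l\<bar> * of_int H ^ \<kappa>"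
    proof (intro exI[of _ "1 / M"] conjI allI impI)
      show "1 / M > 0" using M by simp
      fix F :: "nat \<Rightarrow> int" and H :: int
      assume H: "H \<ge> 1" and FH: "\<forall>l\<le>p. \<bar>F l\<bar> \<le> H" and nz: "(\<Sum>l\<le>p. of_int (F l) * \<xi> ^ l) \<noteq> 0"
      define X where "X = (\<Sum>l\<le>p. of_int (F l) * \<xi> ^ l)"
      \<comment> \<open>The matrix of multiplication by \<open>a ^ (p + D) * X\<close> on the span
        of 1, ..., \<open>\<xi> ^ (D - 1)\<close>. The exponent \<open>p + D\<close> exceeds every
        \<open>j + l\<close> that occurs, so the subtraction does not truncate.\<close>
      define T where "T = (\<lambda>j i. \<Sum>l\<le>p. F l * (a ^ (p + D - (j + l)) * t (j + l) i))"
      have T: "of_int a ^ (p + D) * (\<xi> ^ j * X) = (\<Sum>i<D. of_int (T j i) * \<xi> ^ i)" if "j < D" for j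
      proof -
        have "of_int a ^ (p + D) * (\<xi> ^ j * X) =
            (\<Sum>l\<le>p. of_int (F l) * (of_int a ^ (p + D) * \<xi> ^ (j + l)))"
          by (simp add: X_def sum_distrib_left power_add algebra_simps)
        also have "\<dots> = (\<Sum>l\<le>p. of_int (F l) * (of_int a ^ (p + D - (j + l)) * (\<Sum>i<D. of_int (t (j + l) i) * \<xi> ^ i)))"
        proof (intro sum.cong refl)
          fix l assume "l \<in> {..p}"
          then have "of_int a ^ (p + D) = (of_int a ^ (p + D - (j + l)) * of_int a ^ (j + l) :: real)"
            using that by (subst power_add[symmetric]) simp
          then show "of_int (F l) * (of_int a ^ (p + D) * \<xi> ^ (j + l)) =
            of_int (F l) * (of_int a ^ (p + D - (j + l)) * (\<Sum>i<D. of_int (t (j + l) i) * \<xi> ^ i))"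
            unfolding t[symmetric] by simp
        qed
        also have "\<dots> = (\<Sum>l\<le>p. \<Sum>i<D. of_int (F l * (a ^ (p + D - (j + l)) * t (j + l) i)) * \<xi> ^ i)"
          by (simp add: sum_distrib_left algebra_simps)
        also have "\<dots> = (\<Sum>i<D. of_int (T j i) * \<xi> ^ i)"
          by (subst sum.swap) (simp add: T_def sum_distrib_right)
        finally show ?thesis .
      qed
      have TH: "\<bar>T j i\<bar> \<le> H * L" if "j < D" "i < D" for j i
      proof -
        have "\<bar>T j i\<bar> \<le> (\<Sum>l\<le>p. \<bar>F l * (a ^ (p + D - (j + l)) * t (j + l) i)\<bar>)" unfolding T_def by (rule sum_abs)
        also have "\<dots> \<le> (\<Sum>l\<le>p. H * \<bar>a ^ (p + D - (j + l)) * t (j + l) i\<bar>)"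
          using FH by (intro sum_mono int_mult_abs_mono) auto
        also have "\<dots> = H * (\<Sum>l\<le>p. \<bar>a ^ (p + D - (j + l)) * t (j + l) i\<bar>)" by (simp add: sum_distrib_left)
        also have "(\<Sum>l\<le>p. \<bar>a ^ (p + D - (j + l)) * t (j + l) i\<bar>) \<le>
            (\<Sum>i<D. \<Sum>l\<le>p. \<bar>a ^ (p + D - (j + l)) * t (j + l) i\<bar>)"
          using that by (intro member_le_sum[where f = "\<lambda>i. \<Sum>l\<le>p. \<bar>a ^ (p + D - (j + l)) * t (j + l) i\<bar>"]) (auto intro: sum_nonneg)
        also have "\<dots> \<le> L - 1" unfolding L_def
          using that by (simp, intro member_le_sum[where f = "\<lambda>j. \<Sum>i<D. \<Sum>l\<le>p. \<bar>a ^ (p + D - (j + l)) * t (j + l) i\<bar>"])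
           (auto intro: sum_nonneg)
        finally show ?thesis using H by (simp add: mult_left_mono right_diff_distrib)
      qed
      have HL: "H * L \<ge> 1" using H L1 by (smt (verit) mult_le_cancel_left1)
      have "\<exists>x. (\<exists>i\<in>{..<D}. x i \<noteq> 0) \<and> (\<forall>i\<in>{..<D}. \<bar>x i\<bar> \<le> K * (H * L) ^ \<kappa>) \<and>
          (\<forall>e<D'. (\<Sum>i\<in>{..<D}. T i (Suc e) * x i) = 0)"
        using TH HL by (intro ker) (auto simp: D')
      \<comment> \<open>Instead of a product of conjugates: the combination \<open>W\<close> is
        chosen so that all coordinates of \<open>X * W\<close> but the constant one vanish. Up to
        the power of \<open>a\<close>, \<open>X * W\<close> is then a nonzero integer, while
        \<open>W\<close> is at most a constant times \<open>H ^ \<kappa>\<close>.\<close>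
      then obtain w :: "nat \<Rightarrow> int" where w: "\<exists>i<D. w i \<noteq> 0" "\<And>i. i < D \<Longrightarrow> \<bar>w i\<bar> \<le> K * (H * L) ^ \<kappa>"
        "\<And>e. e < D' \<Longrightarrow> (\<Sum>i<D. T i (Suc e) * w i) = 0" by auto
      define W where "W = (\<Sum>j<D. of_int (w j) * \<xi> ^ j)"
      have W0: "W \<noteq> 0" using indep[of w] w(1) by (simp add: W_def)
      have "of_int a ^ (p + D) * X * W = (\<Sum>j<D. of_int (w j) * (of_int a ^ (p + D) * (\<xi> ^ j * X)))"
        by (simp add: W_def sum_distrib_left algebra_simps)
      also have "\<dots> = (\<Sum>j<D. \<Sum>i<D. of_int (T j i * w j) * \<xi> ^ i)"
        using T by (simp add: sum_distrib_left algebra_simps)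
      also have "\<dots> = (\<Sum>i<D. of_int (\<Sum>j<D. T j i * w j) * \<xi> ^ i)"
        by (subst sum.swap) (simp add: sum_distrib_right)
      also have "\<dots> = of_int (\<Sum>j<D. T j 0 * w j)"
        unfolding D' by (subst sum.lessThan_Suc_shift) (use w(3) in \<open>simp add: D'\<close>)
      finally have N: "of_int a ^ (p + D) * X * W = of_int (\<Sum>j<D. T j 0 * w j)" .
      have "of_int a ^ (p + D) * X * W \<noteq> 0" using a0 nz W0 by (simp add: X_def)
      then have "(\<Sum>j<D. T j 0 * w j) \<noteq> 0" unfolding N of_int_eq_0_iff .
      then have "1 \<le> \<bar>\<Sum>j<D. T j 0 * w j\<bar>" by linarith
      then have "1 \<le> \<bar>of_int a ^ (p + D) * X * W\<bar>" unfolding N of_int_abs[symmetric] of_int_1_le_iff .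
      also have "\<dots> = \<bar>real_of_int a\<bar> ^ (p + D) * \<bar>X\<bar> * \<bar>W\<bar>" by (simp add: abs_mult power_abs)
      also have "\<bar>W\<bar> \<le> (\<Sum>j<D. \<bar>of_int (w j) * \<xi> ^ j\<bar>)" unfolding W_def by (rule sum_abs)
      also have "\<dots> \<le> (\<Sum>j<D. of_int (K * (H * L) ^ \<kappa>) * \<bar>\<xi>\<bar> ^ j)"
        unfolding abs_mult power_abs using w(2) by (intro sum_mono mult_right_mono) (simp_all only: of_int_abs[symmetric] of_int_le_iff lessThan_iff zero_le_power abs_ge_zero)
      also have "\<dots> = of_int (K * (H * L) ^ \<kappa>) * Z" by (simp add: Z_def sum_distrib_left)
      finally have "1 \<le> \<bar>real_of_int a\<bar> ^ (p + D) * \<bar>X\<bar> * (of_int (K * (H * L) ^ \<kappa>) * Z)"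
        by (simp add: mult_left_mono)
      also have "\<dots> = M * (\<bar>X\<bar> * of_int H ^ \<kappa>)" by (simp add: M_def power_mult_distrib algebra_simps)
      finally show "1 / M \<le> \<bar>\<Sum>l\<le>p. of_int (F l) * \<xi> ^ l\<bar> * of_int H ^ \<kappa>"
        using M by (simp add: X_def field_simps)
    qed
  qed
qed

section \<open>Bounded power series with integer coefficients\<close>

text \<open>After splitting off \<open>z ^ subdegree E\<close>, the remaining factor is continuous
  and nonzero at 0. The upper bound makes auxiliary values small; the lower bound shows that they do
  not vanish.\<close>

lemma eval_fps_near_0:
  fixes E :: "complex fps"
  assumes "fps_conv_radius E > 0" "E \<noteq> 0"
  obtains c K where "c > 0" "K > 0"
    "\<forall>\<^sub>F z in nhds 0. c * norm z ^ subdegree E \<le> norm (eval_fps E z) \<and> norm (eval_fps E z) \<le> K * norm z ^ subdegree E"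
proof -
  define M where "M = subdegree E"
  define E' where "E' = fps_shift M E"
  define e where "e = norm (fps_nth E M)"
  have e: "e > 0" using assms by (simp add: e_def M_def)
  have rad: "fps_conv_radius E' > 0" using assms by (simp add: E'_def)
  have E: "E = E' * fps_X ^ M" unfolding E'_def M_def by (rule subdegree_decompose)
  have "continuous (at 0 within UNIV) (eval_fps E')" by (rule continuous_eval_fps) (use rad in \<open>simp add: zero_ereal_def\<close>)
  then have "(eval_fps E' \<longlongrightarrow> eval_fps E' 0) (nhds 0)"
    by (simp add: continuous_within tendsto_nhds_iff)
  then have lim: "((\<lambda>z. norm (eval_fps E' z)) \<longlongrightarrow> e) (nhds 0)"
    using tendsto_norm[of "eval_fps E'" "eval_fps E' 0" "nhds 0"] by (simp add: eval_fps_at_0 E'_def e_def)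
  have "\<forall>\<^sub>F z in nhds 0. norm (eval_fps E' z) > e / 2" "\<forall>\<^sub>F z in nhds 0. norm (eval_fps E' z) < 2 * e"
    by (rule order_tendstoD[OF lim], use e in simp)+
  moreover have "\<forall>\<^sub>F z in nhds 0. z \<in> eball 0 (fps_conv_radius E')"
    using rad by (intro eventually_nhds_in_open) (auto simp: zero_ereal_def)
  ultimately have "\<forall>\<^sub>F z in nhds 0. e / 2 * norm z ^ subdegree E \<le> norm (eval_fps E z) \<and>
      norm (eval_fps E z) \<le> 2 * e * norm z ^ subdegree E"
  proof eventually_elim
    case (elim z)
    have "eval_fps E z = eval_fps E' z * z ^ M"
      by (subst E, subst eval_fps_mult) (use elim(3) in auto)
    then have "norm (eval_fps E z) = norm (eval_fps E' z) * norm z ^ subdegree E"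
      by (simp add: norm_mult norm_power M_def)
    moreover have "e / 2 * norm z ^ subdegree E \<le> norm (eval_fps E' z) * norm z ^ subdegree E"
      "norm (eval_fps E' z) * norm z ^ subdegree E \<le> 2 * e * norm z ^ subdegree E"
      using elim by (intro mult_right_mono; simp)+
    ultimately show ?case by simp
  qed
  then show ?thesis using that[of "e / 2" "2 * e"] e by simp
qed

text \<open>Orthogonality of the characters of the cyclic group of order \<open>L\<close>. Sampling
  at roots of unity is exact for polynomials of degree below \<open>L\<close>, so no integral over
  the circle is needed.\<close>

lemma finite_parseval:
  fixes a :: "nat \<Rightarrow> complex"
  assumes "L > 0"
  shows "(\<Sum>k<L. (norm (\<Sum>i<L. a i * cis (2 * pi * real k / real L) ^ i))\<^sup>2) = real L * (\<Sum>i<L. (norm (a i))\<^sup>2)"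
proof -
  define w where "w = (\<lambda>k. cis (2 * pi * real k / real L))"
  \<comment> \<open>This symmetry turns the sum over sample points \<open>k\<close> into a geometric
    sum with ratio \<open>w i * cnj (w j)\<close>.\<close>
  have swap: "w k ^ i = w i ^ k" for i k
    unfolding w_def Complex.DeMoivre by (rule arg_cong[where f = cis]) simp
  have wL: "w i ^ L = 1" for i
    using assms by (simp add: w_def Complex.DeMoivre)
  have inj: "w i = w j \<Longrightarrow> i = j" if "i < L" "j < L" for i j
    using Complex.bij_betw_roots_unity[OF assms] that by (auto simp: w_def bij_betw_def inj_on_def)
  have orth: "(\<Sum>k<L. w k ^ i * cnj (w k ^ j)) = (if i = j then of_nat L else 0)" if "i < L" "j < L" for i j
  proof -
    have unit: "w j * cnj (w j) = 1" by (simp add: w_def cis_cnj cis_mult)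
    have eq: "w k ^ i * cnj (w k ^ j) = (w i * cnj (w j)) ^ k" for k
      by (simp add: swap power_mult_distrib)
    show ?thesis
    proof (cases "i = j")
      case True
      then show ?thesis unfolding eq using unit by simp
    next
      case False
      have "w i * cnj (w j) \<noteq> 1"
      proof
        assume "w i * cnj (w j) = 1"
        then have "w i * (w j * cnj (w j)) = w j" by (simp add: mult_ac)
        then show False using unit inj[OF that] False by simp
      qed
      moreover have "(w i * cnj (w j)) ^ L = 1"
        using wL by (simp add: power_mult_distrib flip: complex_cnj_power)
      ultimately show ?thesis unfolding eq using False by (simp add: geometric_sum)
    qed
  qed
  have "complex_of_real (\<Sum>k<L. (norm (\<Sum>i<L. a i * w k ^ i))\<^sup>2) =
      (\<Sum>k<L. \<Sum>i<L. \<Sum>j<L. a i * cnj (a j) * (w k ^ i * cnj (w k ^ j)))"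
    by (simp only: of_real_sum complex_norm_square cnj_sum complex_cnj_mult sum_product mult_ac)
  also have "\<dots> = (\<Sum>i<L. \<Sum>k<L. \<Sum>j<L. a i * cnj (a j) * (w k ^ i * cnj (w k ^ j)))"
    by (rule sum.swap)
  also have "\<dots> = (\<Sum>i<L. \<Sum>j<L. \<Sum>k<L. a i * cnj (a j) * (w k ^ i * cnj (w k ^ j)))"
    by (intro sum.cong refl sum.swap)
  also have "\<dots> = (\<Sum>i<L. \<Sum>j<L. a i * cnj (a j) * (if i = j then of_nat L else 0))"
    by (intro sum.cong refl) (simp add: sum_distrib_left[symmetric] orth del: complex_cnj_power)
  also have "\<dots> = (\<Sum>i<L. a i * cnj (a i) * of_nat L)"
    by (simp add: if_distrib cong: if_cong)
  also have "\<dots> = complex_of_real (real L * (\<Sum>i<L. (norm (a i))\<^sup>2))"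
    by (simp only: of_real_mult of_real_sum of_real_of_nat_eq complex_norm_square sum_distrib_left mult_ac)
  finally show ?thesis by (simp only: of_real_eq_iff w_def)
qed

text \<open>On a circle of radius r < 1 the series is within \<open>\<epsilon>\<close> of a long
  enough partial sum, to which the finite Parseval identity applies. Letting first
  \<open>\<epsilon>\<close> tend to 0 and then r to 1 gives the bound.\<close>

lemma bounded_eval_fps_sum_squares:
  fixes G :: "complex fps"
  assumes rad: "fps_conv_radius G \<ge> 1"
    and bd: "\<And>z. norm z < 1 \<Longrightarrow> norm (eval_fps G z) \<le> M"
  shows "(\<Sum>i<m. (norm (fps_nth G i))\<^sup>2) \<le> M\<^sup>2"
proof -
  have M0: "M \<ge> 0" using bd[of 0] by (smt (verit) norm_ge_zero norm_zero)
  have *: "(\<Sum>i<m. (norm (fps_nth G i) * r ^ i)\<^sup>2) \<le> (M + \<epsilon>)\<^sup>2" if r: "0 < r" "r < 1" and eps: "\<epsilon> > 0" for r \<epsilon> :: real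
  proof -
    have sm: "summable (\<lambda>n. norm (fps_nth G n) * r ^ n)"
      using norm_summable_fps[of "of_real r" G] r rad
      by (simp add: norm_mult norm_power less_le_trans[of _ 1] one_ereal_def)
    obtain N where N: "\<And>n. n \<ge> N \<Longrightarrow> norm (\<Sum>i. norm (fps_nth G (i + n)) * r ^ (i + n)) < \<epsilon>"
      using suminf_exist_split[OF eps sm] by auto
    \<comment> \<open>Long enough to contain the first \<open>m\<close> coefficients and to make the
      tail smaller than \<open>\<epsilon>\<close>; \<open>Suc\<close> makes it positive, as
      \<open>finite_parseval\<close> demands.\<close>
    define L where "L = Suc (max m N)"
    have NL: "N \<le> L" by (simp add: L_def)
    have close: "norm (\<Sum>i<L. fps_nth G i * z ^ i) \<le> M + \<epsilon>" if z: "norm z = r" for z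
    proof -
      have nz: "ereal (norm z) < fps_conv_radius G" using r z rad
        by (metis ereal_less(3) less_le_trans)
      have sz: "summable (\<lambda>n. fps_nth G n * z ^ n)" by (rule summable_fps[OF nz])
      have "eval_fps G z = (\<Sum>i. fps_nth G (i + L) * z ^ (i + L)) + (\<Sum>i<L. fps_nth G i * z ^ i)"
        unfolding eval_fps_def by (rule suminf_split_initial_segment[OF sz])
      then have "(\<Sum>i<L. fps_nth G i * z ^ i) = eval_fps G z - (\<Sum>i. fps_nth G (i + L) * z ^ (i + L))"
        by (simp only: add_diff_cancel_left')
      then have "norm (\<Sum>i<L. fps_nth G i * z ^ i) \<le> norm (eval_fps G z) + norm (\<Sum>i. fps_nth G (i + L) * z ^ (i + L))"
        by (simp only: norm_triangle_ineq4)
      also have "norm (\<Sum>i. fps_nth G (i + L) * z ^ (i + L)) \<le> (\<Sum>i. norm (fps_nth G (i + L) * z ^ (i + L)))"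
        by (rule summable_norm, rule summable_ignore_initial_segment[OF norm_summable_fps[OF nz]])
      also have "\<dots> = (\<Sum>i. norm (fps_nth G (i + L)) * r ^ (i + L))"
        by (simp add: norm_mult norm_power z)
      also have "\<dots> < \<epsilon>" using N[OF NL] unfolding real_norm_def by linarith
      finally show ?thesis using bd[of z] z r by simp
    qed
    define w where "w = (\<lambda>k. cis (2 * pi * real k / real L))"
    have "real L * (\<Sum>i<L. (norm (fps_nth G i) * r ^ i)\<^sup>2) = real L * (\<Sum>i<L. (norm (fps_nth G i * of_real r ^ i))\<^sup>2)"
      using r by (simp add: norm_mult norm_power)
    also have "\<dots> = (\<Sum>k<L. (norm (\<Sum>i<L. (fps_nth G i * of_real r ^ i) * w k ^ i))\<^sup>2)"
      unfolding w_def by (rule finite_parseval[symmetric]) (simp add: L_def)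
    also have "\<dots> = (\<Sum>k<L. (norm (\<Sum>i<L. fps_nth G i * (of_real r * w k) ^ i))\<^sup>2)"
      by (simp add: power_mult_distrib mult_ac)
    also have "\<dots> \<le> (\<Sum>k<L. (M + \<epsilon>)\<^sup>2)"
      using r by (intro sum_mono power_mono close) (auto simp: norm_mult w_def)
    also have "\<dots> = real L * (M + \<epsilon>)\<^sup>2" by simp
    finally have "(\<Sum>i<L. (norm (fps_nth G i) * r ^ i)\<^sup>2) \<le> (M + \<epsilon>)\<^sup>2"
      by (simp add: L_def)
    moreover have "(\<Sum>i<m. (norm (fps_nth G i) * r ^ i)\<^sup>2) \<le> (\<Sum>i<L. (norm (fps_nth G i) * r ^ i)\<^sup>2)"
      by (intro sum_mono2) (auto simp: L_def)
    ultimately show ?thesis by linarith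
  qed
  have **: "(\<Sum>i<m. (norm (fps_nth G i) * r ^ i)\<^sup>2) \<le> M\<^sup>2" if r: "0 < r" "r < 1" for r :: real
  proof (rule tendsto_lowerbound)
    show "((\<lambda>\<epsilon>. (M + \<epsilon>)\<^sup>2) \<longlongrightarrow> M\<^sup>2) (at_right 0)" by (rule tendsto_eq_intros refl | simp)+
    show "\<forall>\<^sub>F \<epsilon> in at_right 0. (\<Sum>i<m. (norm (fps_nth G i) * r ^ i)\<^sup>2) \<le> (M + \<epsilon>)\<^sup>2"
      using eventually_at_right_less[of "0::real"] by eventually_elim (rule *[OF r])
  qed simp
  show ?thesis
  proof (rule tendsto_upperbound)
    show "((\<lambda>r. \<Sum>i<m. (norm (fps_nth G i) * r ^ i)\<^sup>2) \<longlongrightarrow> (\<Sum>i<m. (norm (fps_nth G i))\<^sup>2)) (at_left 1)"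
      by (rule tendsto_eq_intros refl | simp)+
    have "\<forall>\<^sub>F r::real in at_left 1. r \<in> {0<..<1}" by (rule eventually_at_left_1) simp
    then show "\<forall>\<^sub>F r in at_left 1. (\<Sum>i<m. (norm (fps_nth G i) * r ^ i)\<^sup>2) \<le> M\<^sup>2"
      by eventually_elim (use ** in auto)
  qed simp
qed

text \<open>Each nonzero integer contributes at least 1 to the sum of squares, so there are at most
  \<open>M\<^sup>2\<close> of them.\<close>

lemma bounded_integral_fps_finite_support:
  fixes G :: "complex fps"
  assumes rad: "fps_conv_radius G \<ge> 1"
    and bd: "\<And>z. norm z < 1 \<Longrightarrow> norm (eval_fps G z) \<le> M"
    and int: "\<And>i. fps_nth G i \<in> \<int>"
  shows "finite {i. fps_nth G i \<noteq> 0}"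
proof (rule ccontr)
  assume "infinite {i. fps_nth G i \<noteq> 0}"
  then obtain S where S: "finite S" "card S = Suc (nat \<lceil>M\<^sup>2\<rceil>)" "S \<subseteq> {i. fps_nth G i \<noteq> 0}"
    using infinite_arbitrarily_large[of "{i. fps_nth G i \<noteq> 0}" "Suc (nat \<lceil>M\<^sup>2\<rceil>)"] by auto
  obtain m where m: "S \<subseteq> {..<m}" using S(1) finite_nat_iff_bounded by blast
  have ge: "(norm (fps_nth G i))\<^sup>2 \<ge> 1" if "i \<in> S" for i
  proof -
    obtain k :: int where k: "fps_nth G i = of_int k" using int[of i] by (elim Ints_cases)
    then have "\<bar>k\<bar> \<ge> 1" using that S by auto
    then show ?thesis by (simp add: k one_le_power flip: of_int_abs)
  qed
  have "real (card S) = (\<Sum>i\<in>S. 1)" by simp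
  also have "\<dots> \<le> (\<Sum>i\<in>S. (norm (fps_nth G i))\<^sup>2)" by (intro sum_mono ge)
  also have "\<dots> \<le> (\<Sum>i<m. (norm (fps_nth G i))\<^sup>2)" using m by (intro sum_mono2) auto
  also have "\<dots> \<le> M\<^sup>2" by (rule bounded_eval_fps_sum_squares[OF rad bd])
  finally show False using S(2) by linarith
qed

section \<open>Convergence and evaluation of finite combinations of power series\<close>

lemma fps_conv_radius_sum_ge:
  fixes f :: "'i \<Rightarrow> complex fps"
  assumes "\<And>i. i \<in> A \<Longrightarrow> r \<le> fps_conv_radius (f i)"
  shows "r \<le> fps_conv_radius (\<Sum>i\<in>A. f i)"
  using assms
proof (induction A rule: infinite_finite_induct)
  case (insert x A)
  then have "r \<le> min (fps_conv_radius (f x)) (fps_conv_radius (sum f A))" by simp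
  also have "\<dots> \<le> fps_conv_radius (f x + sum f A)" by (rule fps_conv_radius_add)
  finally show ?case using insert by simp
qed simp_all

lemma fps_conv_radius_mult_ge:
  fixes f g :: "complex fps"
  assumes "r \<le> fps_conv_radius f" "r \<le> fps_conv_radius g"
  shows "r \<le> fps_conv_radius (f * g)"
  using fps_conv_radius_mult[of f g] assms by (meson min.boundedI order_trans)

lemma fps_conv_radius_diff_ge:
  fixes f g :: "complex fps"
  assumes "r \<le> fps_conv_radius f" "r \<le> fps_conv_radius g"
  shows "r \<le> fps_conv_radius (f - g)"
  using fps_conv_radius_diff[of f g] assms by (meson min.boundedI order_trans)

lemma fps_conv_radius_power_ge:
  fixes f :: "complex fps"
  assumes "r \<le> fps_conv_radius f"
  shows "r \<le> fps_conv_radius (f ^ n)"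
  using fps_conv_radius_power[of f n] assms by (meson order_trans)

lemma eval_fps_sum:
  fixes f :: "'i \<Rightarrow> complex fps"
  assumes "\<And>i. i \<in> A \<Longrightarrow> r \<le> fps_conv_radius (f i)" "norm z < r"
  shows "eval_fps (\<Sum>i\<in>A. f i) z = (\<Sum>i\<in>A. eval_fps (f i) z)"
  using assms
proof (induction A rule: infinite_finite_induct)
  case (insert x A)
  then have "r \<le> fps_conv_radius (f x)" "r \<le> fps_conv_radius (sum f A)"
    by (auto intro: fps_conv_radius_sum_ge)
  then have "norm z < fps_conv_radius (f x)" "norm z < fps_conv_radius (sum f A)"
    using insert.prems(2) by (metis less_ereal.simps(1) less_le_trans)+
  then have "eval_fps (f x + sum f A) z = eval_fps (f x) z + eval_fps (sum f A) z"
    by (rule eval_fps_add)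
  then show ?case using insert by simp
qed simp_all

lemma norm_poly_le:
  fixes p :: "complex poly"
  assumes "norm z \<le> 1"
  shows "norm (poly p z) \<le> (\<Sum>i\<le>degree p. norm (coeff p i))"
proof -
  have "norm (poly p z) \<le> (\<Sum>i\<le>degree p. norm (coeff p i * z ^ i))"
    unfolding poly_altdef by (rule norm_sum)
  also have "\<dots> \<le> (\<Sum>i\<le>degree p. norm (coeff p i))"
    using assms by (intro sum_mono) (auto simp: norm_mult norm_power intro!: mult_left_le power_le_one)
  finally show ?thesis .
qed

text \<open>Multiplying by the leading coefficient turns \<open>F\<close> into an integral element over the
  polynomials, which is bounded on the unit disk.\<close>

lemma algebraic_fps_finite_support:
  fixes F :: "complex fps" and a :: "nat \<Rightarrow> complex poly"
  assumes rad: "fps_conv_radius F \<ge> 1"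
    and F_int: "\<And>n. fps_nth F n \<in> \<int>" and a_int: "\<And>i. coeff (a J) i \<in> \<int>"
    and aJ: "a J \<noteq> 0" and rel: "(\<Sum>j\<le>J. fps_of_poly (a j) * F ^ j) = 0"
  shows "finite {i. fps_nth (fps_of_poly (a J) * F) i \<noteq> 0}"
proof -
  have "J \<noteq> 0"
  proof
    assume "J = 0"
    then have "fps_of_poly (a 0) = fps_of_poly 0" using rel by simp
    then have "a 0 = 0" by (simp only: fps_of_poly_eq_iff)
    then show False using aJ \<open>J = 0\<close> by simp
  qed
  then obtain J' where J': "J = Suc J'" by (cases J) auto
  define K where "K = (\<Sum>j\<le>J. \<Sum>i\<le>degree (a j). norm (coeff (a j) i))"
  have K0: "K \<ge> 0" by (simp add: K_def sum_nonneg)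
  have K: "norm (poly (a j) z) \<le> K" if "norm z < 1" "j \<le> J" for z j
  proof -
    have "norm (poly (a j) z) \<le> (\<Sum>i\<le>degree (a j). norm (coeff (a j) i))"
      using that by (intro norm_poly_le) simp
    also have "\<dots> \<le> K" unfolding K_def
      using that by (intro member_le_sum[where f = "\<lambda>j. \<Sum>i\<le>degree (a j). norm (coeff (a j) i)"]) (auto intro: sum_nonneg)
    finally show ?thesis .
  qed
  show ?thesis
  proof (rule bounded_integral_fps_finite_support)
    show "fps_conv_radius (fps_of_poly (a J) * F) \<ge> 1"
      using rad by (intro fps_conv_radius_mult_ge) auto
    show "fps_nth (fps_of_poly (a J) * F) i \<in> \<int>" for i
      unfolding fps_mult_nth using F_int a_int by (intro Ints_sum Ints_mult) auto
    fix z :: complex assume z: "norm z < 1"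
    have zF: "norm z < fps_conv_radius F" using z rad by (metis ereal_less(3) less_le_trans)
    define w where "w = eval_fps F z"
    have evJ: "eval_fps (fps_of_poly (a j) * F ^ j) z = poly (a j) z * w ^ j" for j
    proof -
      have "norm z < fps_conv_radius (F ^ j)" using zF fps_conv_radius_power by (rule less_le_trans)
      then show ?thesis by (subst eval_fps_mult) (auto simp: eval_fps_power zF w_def)
    qed
    have "0 = eval_fps (\<Sum>j\<le>J. fps_of_poly (a j) * F ^ j) z" by (simp add: rel)
    also have "\<dots> = (\<Sum>j\<le>J. poly (a j) z * w ^ j)"
      using rad z by (subst eval_fps_sum[where r = 1])
        (auto simp: evJ one_ereal_def[symmetric] intro!: fps_conv_radius_mult_ge fps_conv_radius_power_ge)
    also have "\<dots> = poly (a J) z * w ^ J + (\<Sum>j\<le>J'. poly (a j) z * w ^ j)"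
      by (simp add: J')
    finally have eq: "poly (a J) z * w ^ J = - (\<Sum>j\<le>J'. poly (a j) z * w ^ j)"
      by (simp add: eq_neg_iff_add_eq_0)
    \<comment> \<open>If \<open>w\<close> is small, the bound is immediate. Otherwise every lower
      power of \<open>w\<close> is at most \<open>norm w ^ J'\<close>, and this factor cancels from
      the relation.\<close>
    have "norm (poly (a J) z * w) \<le> real J * K"
    proof (cases "norm w \<le> 1")
      case True
      have "norm (poly (a J) z * w) \<le> K * 1"
        unfolding norm_mult using True K[OF z, of J] K0 by (intro mult_mono) auto
      also have "\<dots> \<le> real J * K" using K0 by (simp add: J' algebra_simps)
      finally show ?thesis .
    next
      case False
      then have w1: "norm w > 1" by simp
      have "norm (poly (a J) z * w) * norm w ^ J' = norm (poly (a J) z * w ^ J)"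
        by (simp add: norm_mult norm_power J')
      also have "\<dots> \<le> (\<Sum>j\<le>J'. norm (poly (a j) z * w ^ j))"
        unfolding eq norm_minus_cancel by (rule norm_sum)
      also have "\<dots> \<le> (\<Sum>j\<le>J'. K * norm w ^ J')"
        unfolding norm_mult norm_power using w1 K[OF z] K0 J'
        by (intro sum_mono mult_mono power_increasing) auto
      also have "\<dots> = (real J * K) * norm w ^ J'" by (simp add: J' algebra_simps)
      finally have *: "norm (poly (a J) z * w) * norm w ^ J' \<le> (real J * K) * norm w ^ J'" .
      have "norm w ^ J' > 0" using w1 by (intro zero_less_power) linarith
      with * show ?thesis by (rule mult_right_le_imp_le)
    qed
    then show "norm (eval_fps (fps_of_poly (a J) * F) z) \<le> real J * K"
      by (subst eval_fps_mult) (auto simp: zF w_def)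
  qed
qed

section \<open>Hankel determinants and Pade approximants\<close>

lemma hankel_kernel_trivial:
  fixes x :: "nat \<Rightarrow> int"
  assumes det: "hankel_det c n \<noteq> 0" and ker: "\<And>i. i < n \<Longrightarrow> (\<Sum>j<n. c (i + j) * x j) = 0" and j: "j < n"
  shows "x j = 0"
proof (rule ccontr)
  assume xj: "x j \<noteq> 0"
  define A where "A = Matrix.mat n n (\<lambda>(i, j). c (i + j))"
  have A: "A \<in> carrier_mat n n" by (simp add: A_def)
  have "A *\<^sub>v Matrix.vec n x = 0\<^sub>v n"
  proof (rule eq_vecI)
    fix i assume "i < dim_vec (0\<^sub>v n :: int Matrix.vec)"
    then show "vec_index (A *\<^sub>v Matrix.vec n x) i = vec_index (0\<^sub>v n) i"
      using ker[of i] by (simp add: A_def scalar_prod_def lessThan_atLeast0)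
  qed (simp add: A_def)
  moreover have "Matrix.vec n x \<noteq> 0\<^sub>v n"
  proof
    assume "Matrix.vec n x = 0\<^sub>v n"
    then have "vec_index (Matrix.vec n x) j = vec_index (0\<^sub>v n) j" by simp
    then show False using xj j by simp
  qed
  moreover have "Matrix.vec n x \<in> carrier_vec n" by simp
  ultimately have "Determinant.det A = 0" using det_0_iff_vec_prod_zero[OF A] by blast
  then show False using det by (simp add: hankel_det_def A_def)
qed

text \<open>The coefficients of Q f at the n positions n - 1, ..., 2n - 2 are the Hankel matrix
  applied to the reversed coefficient vector of \<open>Q\<close>, and this matrix is
  nonsingular.\<close>

lemma hankel_no_small_denominator:
  fixes Q :: "int poly"
  assumes det: "hankel_det c n \<noteq> 0" and deg: "degree Q < n"
    and van: "\<And>l. n - 1 \<le> l \<Longrightarrow> l \<le> 2 * n - 2 \<Longrightarrow> fps_nth (fps_of_poly Q * Abs_fps c) l = 0"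
  shows "Q = 0"
proof -
  have "(\<Sum>j<n. c (i + j) * coeff Q (n - Suc j)) = 0" if i: "i < n" for i
  proof -
    have "0 = fps_nth (fps_of_poly Q * Abs_fps c) (n - 1 + i)" using van[of "n - 1 + i"] i by simp
    also have "\<dots> = (\<Sum>t\<in>{0..n - 1 + i}. coeff Q t * c (n - 1 + i - t))"
      by (simp add: fps_mult_nth)
    also have "\<dots> = (\<Sum>t<n. coeff Q t * c (n - 1 + i - t))"
      using deg by (intro sum.mono_neutral_right) (auto simp: coeff_eq_0)
    also have "\<dots> = (\<Sum>j<n. coeff Q (n - Suc j) * c (n - 1 + i - (n - Suc j)))"
      by (rule sum.nat_diff_reindex[symmetric])
    also have "\<dots> = (\<Sum>j<n. c (i + j) * coeff Q (n - Suc j))"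
      by (intro sum.cong refl) (simp add: mult.commute add.commute)
    finally show ?thesis by simp
  qed
  then have z: "coeff Q (n - Suc j) = 0" if "j < n" for j
    using hankel_kernel_trivial[OF det, of "\<lambda>j. coeff Q (n - Suc j)" j] that by blast
  show "Q = 0"
  proof (rule poly_eqI)
    fix i
    show "coeff Q i = coeff 0 i"
    proof (cases "i < n")
      case True
      then have "n - Suc (n - Suc i) = i" by simp
      then show ?thesis using z[of "n - Suc i"] True by simp
    next
      case False
      then show ?thesis using deg by (simp add: coeff_eq_0)
    qed
  qed
qed

text \<open>So f is not a rational function: if Q f were a polynomial, the window n - 1, ..., 2n - 2
  would lie beyond its degree for a large n = \<open>n i\<close>.\<close>

lemma hankel_infinite_support:
  fixes Q :: "int poly" and n :: "nat \<Rightarrow> nat"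
  assumes mono: "strict_mono n" and det: "\<And>i. hankel_det c (n i) \<noteq> 0" and Q: "Q \<noteq> 0"
  shows "infinite {l. fps_nth (fps_of_poly Q * Abs_fps c) l \<noteq> 0}"
proof
  assume "finite {l. fps_nth (fps_of_poly Q * Abs_fps c) l \<noteq> 0}"
  then obtain m where m: "{l. fps_nth (fps_of_poly Q * Abs_fps c) l \<noteq> 0} \<subseteq> {..<m}"
    using finite_nat_iff_bounded by blast
  define i where "i = Suc (max m (degree Q))"
  have "n i \<ge> i" using mono by (rule strict_mono_imp_increasing)
  then have "Q = 0"
    using m by (intro hankel_no_small_denominator[OF det[of i]]) (fastforce simp: i_def)+
  then show False using Q by simp
qed

lemma fps_nth_of_int_mult:
  "fps_nth (fps_of_poly (map_poly of_int Q) * Abs_fps (\<lambda>n. of_int (c n))) l =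
     (of_int (fps_nth (fps_of_poly Q * Abs_fps c) l) :: complex)"
  by (simp add: fps_mult_nth coeff_map_poly)

text \<open>\<open>Q\<close> solves n equations in its n + 1 coefficients, namely that Q f has no
  terms of degree n, ..., 2n - 1. The two determinants have different tasks: H_n excludes Q(0) = 0,
  since Q/z would be a denominator of degree below n, and H_n' bounds the first later nonzero
  coefficient.\<close>

lemma pade_denominator:
  assumes det: "hankel_det c n \<noteq> 0" and det': "hankel_det c n' \<noteq> 0" and nn': "n < n'"
  obtains Q :: "int poly" and M where "coeff Q 0 \<noteq> 0" "degree Q \<le> n" "2 * n \<le> M" "M < n + n'"
    "fps_nth (fps_of_poly Q * Abs_fps c) M \<noteq> 0"
    "\<And>l. n \<le> l \<Longrightarrow> l < M \<Longrightarrow> fps_nth (fps_of_poly Q * Abs_fps c) l = 0"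
proof -
  obtain x where x: "\<exists>t\<in>{..n}. x t \<noteq> 0" "\<And>e. e < n \<Longrightarrow> (\<Sum>t\<in>{..n}. c (n + e - t) * x t) = 0"
    using kernel_vector[of "{..n}" n "\<lambda>e t. c (n + e - t)"] by auto
  define Q where "Q = (\<Sum>t\<le>n. monom (x t) t)"
  have cQ: "coeff Q i = (if i \<le> n then x i else 0)" for i
    by (simp add: Q_def coeff_sum if_distrib cong: if_cong)
  have Q0: "Q \<noteq> 0" using x(1) cQ by (metis atMost_iff coeff_0)
  have degQ: "degree Q \<le> n" by (rule degree_le) (simp add: cQ)
  have van: "fps_nth (fps_of_poly Q * Abs_fps c) l = 0" if "n \<le> l" "l < 2 * n" for l
  proof -
    have "fps_nth (fps_of_poly Q * Abs_fps c) l = (\<Sum>t\<in>{0..l}. coeff Q t * c (l - t))"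
      by (simp add: fps_mult_nth)
    also have "\<dots> = (\<Sum>t\<in>{..n}. c (n + (l - n) - t) * x t)"
      using that by (intro sum.mono_neutral_cong_right) (auto simp: cQ)
    also have "\<dots> = 0" using that by (intro x(2)) simp
    finally show ?thesis .
  qed
  have c0: "coeff Q 0 \<noteq> 0"
  proof
    assume c0: "coeff Q 0 = 0"
    obtain k Q1 where "Q = pCons k Q1" by (cases Q)
    then have Q1: "Q = pCons 0 Q1" "Q1 \<noteq> 0" using c0 Q0 by auto
    then have deg1: "degree Q1 < n" using degQ by simp
    have "fps_of_poly Q * Abs_fps c = (fps_of_poly Q1 * Abs_fps c) * fps_X"
      by (simp add: Q1 fps_of_poly_pCons mult_ac)
    note eq = this
    have sh: "fps_nth (fps_of_poly Q1 * Abs_fps c) l = fps_nth (fps_of_poly Q * Abs_fps c) (Suc l)" for l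
      unfolding eq by simp
    have "Q1 = 0"
      using deg1 by (intro hankel_no_small_denominator[OF det deg1]) (auto simp: sh intro!: van)
    then show False using Q1 by simp
  qed
  have "\<exists>l. n \<le> l \<and> fps_nth (fps_of_poly Q * Abs_fps c) l \<noteq> 0 \<and> l < n + n'"
  proof (rule ccontr)
    assume "\<nexists>l. n \<le> l \<and> fps_nth (fps_of_poly Q * Abs_fps c) l \<noteq> 0 \<and> l < n + n'"
    then have z: "fps_nth (fps_of_poly Q * Abs_fps c) l = 0" if "n \<le> l" "l < n + n'" for l
      using that by auto
    \<comment> \<open>The shift by \<open>k\<close> raises the degree to at most n' - 1 and moves
      the assumed gap n, ..., n + n' - 1 of Q f exactly onto the window n' - 1, ..., 2n' - 2 of
      H_n'.\<close>
    define k where "k = n' - 1 - n"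
    have "monom 1 k * Q = 0"
    proof (rule hankel_no_small_denominator[OF det'])
      show "degree (monom 1 k * Q) < n'"
        using degQ Q0 nn' by (simp add: degree_mult_eq degree_monom_eq k_def)
      fix l assume l: "n' - 1 \<le> l" "l \<le> 2 * n' - 2"
      have "fps_of_poly (monom 1 k * Q) * Abs_fps c = fps_X ^ k * (fps_of_poly Q * Abs_fps c)"
        by (simp add: fps_of_poly_mult fps_of_poly_monom' mult_ac)
      then have "fps_nth (fps_of_poly (monom 1 k * Q) * Abs_fps c) l =
          (if l < k then 0 else fps_nth (fps_of_poly Q * Abs_fps c) (l - k))"
        by (simp only: fps_X_power_mult_nth)
      also have "\<dots> = 0" using l nn' by (auto intro!: z simp: k_def)
      finally show "fps_nth (fps_of_poly (monom 1 k * Q) * Abs_fps c) l = 0" .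
    qed
    then show False using Q0 by simp
  qed
  then obtain l0 where l0: "n \<le> l0" "fps_nth (fps_of_poly Q * Abs_fps c) l0 \<noteq> 0" "l0 < n + n'" by blast
  define M where "M = (LEAST l. n \<le> l \<and> fps_nth (fps_of_poly Q * Abs_fps c) l \<noteq> 0)"
  have M: "n \<le> M \<and> fps_nth (fps_of_poly Q * Abs_fps c) M \<noteq> 0"
    unfolding M_def by (rule LeastI[of _ l0]) (use l0 in auto)
  have Mmin: "fps_nth (fps_of_poly Q * Abs_fps c) l = 0" if "n \<le> l" "l < M" for l
    using not_less_Least[of l "\<lambda>l. n \<le> l \<and> fps_nth (fps_of_poly Q * Abs_fps c) l \<noteq> 0"] that
    unfolding M_def by blast
  have "M \<le> l0" unfolding M_def by (rule Least_le) (use l0 in auto)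
  moreover have "2 * n \<le> M" using M van by (meson not_le)
  ultimately show ?thesis using that[of Q M] c0 degQ M Mmin l0 by auto
qed

text \<open>\<open>P\<close> is Q f truncated below degree n. The order \<open>M\<close> of the
  remainder is known exactly because the approximation error is needed from above (2n <= M) and from
  below (M < n + n').\<close>

lemma pade_approximant:
  assumes det: "hankel_det c n \<noteq> 0" and det': "hankel_det c n' \<noteq> 0" and nn': "n < n'"
  obtains Q P :: "int poly" and M where "coeff Q 0 \<noteq> 0" "degree Q \<le> n" "degree P \<le> n" "2 * n \<le> M" "M < n + n'"
    "fps_of_poly (map_poly of_int Q) * Abs_fps (\<lambda>n. of_int (c n)) - fps_of_poly (map_poly of_int P) \<noteq> (0 :: complex fps)"
    "subdegree (fps_of_poly (map_poly of_int Q) * Abs_fps (\<lambda>n. of_int (c n)) - fps_of_poly (map_poly of_int P) :: complex fps) = M"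
proof -
  obtain Q :: "int poly" and M where Q: "coeff Q 0 \<noteq> 0" "degree Q \<le> n" "2 * n \<le> M" "M < n + n'"
    "fps_nth (fps_of_poly Q * Abs_fps c) M \<noteq> 0"
    "\<And>l. n \<le> l \<Longrightarrow> l < M \<Longrightarrow> fps_nth (fps_of_poly Q * Abs_fps c) l = 0"
    using pade_denominator[OF assms] by blast
  define P where "P = (\<Sum>l<n. monom (fps_nth (fps_of_poly Q * Abs_fps c) l) l)"
  have cP: "coeff P i = (if i < n then fps_nth (fps_of_poly Q * Abs_fps c) i else 0)" for i
    by (simp add: P_def coeff_sum if_distrib cong: if_cong)
  define R where "R = (fps_of_poly (map_poly of_int Q) * Abs_fps (\<lambda>n. of_int (c n)) - fps_of_poly (map_poly of_int P) :: complex fps)"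
  have R: "fps_nth R l = of_int (fps_nth (fps_of_poly Q * Abs_fps c) l - coeff P l)" for l
    by (simp add: R_def fps_nth_of_int_mult coeff_map_poly)
  have RM: "fps_nth R M \<noteq> 0" using Q(3,5) by (auto simp: R cP)
  have "subdegree R = M"
    by (rule subdegreeI[OF RM]) (use Q(6) in \<open>auto simp: R cP\<close>)
  moreover have "R \<noteq> 0" using RM by auto
  moreover have "degree P \<le> n" by (rule degree_le) (simp add: cP)
  ultimately show ?thesis using that[of Q P M] Q by (simp add: R_def)
qed

section \<open>The Mahler functional equation\<close>

lemma map_poly_of_int_add: "map_poly of_int (p + q) = (map_poly of_int p + map_poly of_int q :: 'a :: comm_ring_1 poly)"
  by (intro poly_eqI) (simp add: coeff_map_poly)

lemma map_poly_of_int_mult: "map_poly of_int (p * q) = (map_poly of_int p * map_poly of_int q :: 'a :: comm_ring_1 poly)"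
  by (intro poly_eqI) (simp add: coeff_map_poly coeff_mult)

text \<open>The constant term -1 of the divisor is a unit, so division from the low-order end stays
  in the integers: with p = a + z q one has p = z (q + a \<open>\<beta>\<close>) - a
  (\<open>\<beta>\<close> z - 1), and q + a \<open>\<beta>\<close> has smaller degree and the same
  root.\<close>

lemma linear_dvd_int_poly:
  fixes p :: "int poly"
  assumes "\<beta> \<noteq> 0" "poly (map_poly of_int p) (1 / of_int \<beta> :: complex) = 0"
  shows "[:-1, \<beta>:] dvd p"
  using assms(2)
proof (induction "degree p" arbitrary: p rule: less_induct)
  case less
  obtain a q where p: "p = pCons a q" by (cases p)
  have val: "of_int a + 1 / of_int \<beta> * poly (map_poly of_int q) (1 / of_int \<beta> :: complex) = 0"
    using less.prems by (simp add: p map_poly_pCons)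
  show ?case
  proof (cases "q = 0")
    case True
    then show ?thesis using val by (simp add: p)
  next
    case False
    define q' where "q' = q + [:a * \<beta>:]"
    have "poly (map_poly of_int q') (1 / of_int \<beta> :: complex) = of_int \<beta> * (of_int a + 1 / of_int \<beta> * poly (map_poly of_int q) (1 / of_int \<beta>))"
      using assms(1) by (simp add: q'_def map_poly_of_int_add map_poly_pCons field_simps)
    moreover have "degree q' < degree p"
      using False degree_add_le[of q "degree q" "[:a * \<beta>:]"] by (simp add: q'_def p)
    ultimately have "[:-1, \<beta>:] dvd q'" using less.hyps val by simp
    moreover have "p = [:0, 1:] * q' - [:a:] * [:-1, \<beta>:]"
      by (simp add: p q'_def)
    ultimately show ?thesis by (metis dvd_diff dvd_mult dvd_refl)
  qed
qed

lemma zero_outside_finite_imp_zero: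
  fixes h :: "complex \<Rightarrow> complex"
  assumes "isCont h z" "finite S" "norm z < 1" "\<And>w. norm w < 1 \<Longrightarrow> w \<notin> S \<Longrightarrow> h w = 0"
  shows "h z = 0"
proof -
  have "\<forall>\<^sub>F w in at z. w \<notin> S"
    using islimpt_finite[OF assms(2), of z] by (simp add: islimpt_iff_eventually)
  moreover have "\<forall>\<^sub>F w in at z. w \<in> ball 0 1"
    using assms(3) by (intro eventually_at_in_open') auto
  ultimately have "\<forall>\<^sub>F w in at z. h w = 0"
    by eventually_elim (use assms(4) in auto)
  then have "h \<midarrow>z\<rightarrow> 0" by (rule tendsto_eventually)
  moreover have "h \<midarrow>z\<rightarrow> h z" using assms(1) by (simp add: isCont_def)
  ultimately show ?thesis using tendsto_unique[of "at z" h 0 "h z"] by simp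
qed

text \<open>Cancelling common zeros of \<open>A\<close> and \<open>B\<close> at points \<open>1 / N\<close> is possible over the integers,
  because such a zero splits off the primitive factor \<open>N z - 1\<close>.\<close>

lemma mahler_equation_no_zeros:
  fixes A B C :: "int poly" and g :: "complex \<Rightarrow> complex"
  assumes d: "d \<ge> 2" and cont: "\<And>z. norm z < 1 \<Longrightarrow> isCont g z" and B: "B \<noteq> 0"
    and feq: "\<And>z. norm z < 1 \<Longrightarrow> poly (map_poly of_int B) z \<noteq> 0 \<Longrightarrow>
       poly (map_poly of_int B) z * g z = poly (map_poly of_int A) z + poly (map_poly of_int (B * C)) z * g (z ^ d)"
  obtains B' A' :: "int poly" where
    "\<And>z. norm z < 1 \<Longrightarrow> poly (map_poly of_int B') z * g z =
       poly (map_poly of_int A') z + poly (map_poly of_int (B' * C)) z * g (z ^ d)"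
    "\<And>N::nat. N \<ge> 2 \<Longrightarrow> poly (map_poly of_int B') (1 / of_nat N :: complex) \<noteq> 0"
proof -
  define good where "good = (\<lambda>A B. \<forall>z. norm z < 1 \<longrightarrow> poly (map_poly of_int B) z * g z =
       poly (map_poly of_int A) z + poly (map_poly of_int (B * C)) z * g (z ^ d))"
  \<comment> \<open>Both sides are continuous, so finitely many exceptional points do no harm. This
    is used twice: for the zeros of the given \<open>B\<close>, and for the point 1/N after a factor
    has been cancelled.\<close>
  have ext: "good A B" if "finite S" and S: "\<And>z. norm z < 1 \<Longrightarrow> z \<notin> S \<Longrightarrow> poly (map_poly of_int B) z * g z =
       poly (map_poly of_int A) z + poly (map_poly of_int (B * C)) z * g (z ^ d)" for A B S
    unfolding good_def
  proof (intro allI impI)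
    fix z :: complex assume z: "norm z < 1"
    then have zd: "norm (z ^ d) < 1" using d by (simp add: norm_power power_less_one_iff)
    define h where "h = (\<lambda>z. poly (map_poly of_int B) z * g z -
       (poly (map_poly of_int A) z + poly (map_poly of_int (B * C)) z * g (z ^ d)))"
    have "isCont h z" unfolding h_def
      by (intro continuous_intros cont z isCont_o2[where f = "\<lambda>z. z ^ d" and g = g] zd)
    then have "h z = 0" by (rule zero_outside_finite_imp_zero[OF _ \<open>finite S\<close> z]) (simp add: h_def S)
    then show "poly (map_poly of_int B) z * g z =
       poly (map_poly of_int A) z + poly (map_poly of_int (B * C)) z * g (z ^ d)" by (simp add: h_def)
  qed
  have nz: "(map_poly of_int B :: complex poly) \<noteq> 0" if "B \<noteq> 0" for B :: "int poly"
    using that by (simp add: poly_eq_iff coeff_map_poly)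
  have "good A B"
    by (rule ext[OF poly_roots_finite[OF nz[OF B]]]) (use feq in simp)
  define cand where "cand = (\<lambda>B. B \<noteq> 0 \<and> (\<exists>A. good A B))"
  have "cand B" using \<open>good A B\<close> B by (auto simp: cand_def)
  \<comment> \<open>A denominator of least degree admits no cancellation; a zero at 1/N would allow
    one.\<close>
  then obtain B' where "cand B'" and min: "\<forall>B''. cand B'' \<longrightarrow> degree B' \<le> degree B''"
    using ex_has_least_nat[of cand B degree] by metis
  then obtain A' where A': "good A' B'" and B': "B' \<noteq> 0" by (auto simp: cand_def)
  have "poly (map_poly of_int B') (1 / of_nat N :: complex) \<noteq> 0" if N: "N \<ge> 2" for N :: nat
  proof
    assume zB: "poly (map_poly of_int B') (1 / of_nat N :: complex) = 0"
    have "norm (1 / of_nat N :: complex) < 1" using N by (simp add: norm_divide)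
    \<comment> \<open>\<open>g\<close> is finite at 1/N and at its d-th power, so both terms with
      the factor \<open>B'\<close> vanish there and force the numerator to vanish too.\<close>
    then have zA: "poly (map_poly of_int A') (1 / of_nat N :: complex) = 0"
      using A' zB by (auto simp: good_def map_poly_of_int_mult)
    have "[:-1, int N:] dvd B'" "[:-1, int N:] dvd A'"
      using zA zB N by (auto intro!: linear_dvd_int_poly)
    then obtain B1 A1 where 1: "B' = [:-1, int N:] * B1" "A' = [:-1, int N:] * A1" by (elim dvdE)
    have lin: "poly (map_poly of_int [:-1, int N:]) z = (of_nat N * z - 1 :: complex)" for z
      by (simp add: map_poly_pCons)
    have "good A1 B1"
    proof (rule ext[of "{1 / of_nat N}"])
      fix z :: complex assume z: "norm z < 1" "z \<notin> {1 / of_nat N}"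
      then have n0: "of_nat N * z - 1 \<noteq> 0" using N by (auto simp: field_simps)
      have "(of_nat N * z - 1) * (poly (map_poly of_int B1) z * g z) =
         (of_nat N * z - 1) * (poly (map_poly of_int A1) z + poly (map_poly of_int (B1 * C)) z * g (z ^ d))"
        using A'[unfolded good_def, rule_format, OF z(1)]
        by (simp only: 1 map_poly_of_int_mult poly_mult lin algebra_simps)
      then show "poly (map_poly of_int B1) z * g z =
         poly (map_poly of_int A1) z + poly (map_poly of_int (B1 * C)) z * g (z ^ d)"
        using n0 by simp
    qed simp
    moreover have "B1 \<noteq> 0" using 1 B' by auto
    moreover from this have "degree B' = 1 + degree B1"
      unfolding 1 using N by (subst degree_mult_eq) auto
    ultimately show False using min[rule_format, of B1] by (auto simp: cand_def)
  qed
  then show ?thesis using that[of B' A'] A' by (auto simp: good_def)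
qed

lemma int_poly_scaled:
  fixes P :: "int poly"
  assumes deg: "degree P \<le> e" and N: "N > 0"
  obtains z :: int where "of_int z = of_nat N ^ e * poly (map_poly of_int P) (1 / of_nat N :: complex)"
    "\<bar>z\<bar> \<le> (\<Sum>i\<le>degree P. \<bar>coeff P i\<bar>) * int N ^ e"
proof -
  define z where "z = (\<Sum>i\<le>degree P. coeff P i * int N ^ (e - i))"
  have "of_int z = (\<Sum>i\<le>degree P. of_int (coeff P i) * (of_nat N ^ e * (1 / of_nat N) ^ i :: complex))"
    unfolding z_def using deg N
    by (simp, intro sum.cong refl) (auto simp: power_diff power_divide)
  also have "\<dots> = of_nat N ^ e * poly (map_poly of_int P) (1 / of_nat N)"
    by (simp add: poly_altdef degree_map_poly coeff_map_poly sum_distrib_left mult_ac)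
  finally have 1: "of_int z = of_nat N ^ e * poly (map_poly of_int P) (1 / of_nat N :: complex)" .
  have "\<bar>z\<bar> \<le> (\<Sum>i\<le>degree P. \<bar>coeff P i * int N ^ (e - i)\<bar>)" unfolding z_def by (rule sum_abs)
  also have "\<dots> \<le> (\<Sum>i\<le>degree P. \<bar>coeff P i\<bar> * int N ^ e)"
    unfolding abs_mult using N by (intro sum_mono mult_left_mono) (auto intro!: power_increasing)
  also have "\<dots> = (\<Sum>i\<le>degree P. \<bar>coeff P i\<bar>) * int N ^ e" by (simp add: sum_distrib_right)
  finally show ?thesis using that 1 by blast
qed

text \<open>Since N (k + 1) = (N k)^d, the equation at 1/N k links the values at two consecutive
  points, and scaling by (N k)^e makes its coefficients integers. The heights multiply, but the
  product of all earlier N j stays below a fixed power of N k because d >= 2. So \<open>G\<close>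
  does not depend on \<open>k\<close>.\<close>

lemma mahler_iteration:
  fixes A B C :: "int poly" and g :: "complex \<Rightarrow> complex" and N :: "nat \<Rightarrow> nat"
  assumes d: "d \<ge> 2" and b: "b \<ge> 2" and N_def: "N = (\<lambda>k. b ^ (d ^ k))"
    and Bnz: "\<And>k. poly (map_poly of_int B) (1 / of_nat (N k) :: complex) \<noteq> 0"
    and Cnz: "\<And>k. poly (map_poly of_int C) (1 / of_nat (N k) :: complex) \<noteq> 0"
    and feq: "\<And>z. norm z < 1 \<Longrightarrow> poly (map_poly of_int B) z * g z =
       poly (map_poly of_int A) z + poly (map_poly of_int (B * C)) z * g (z ^ d)"
  obtains D u v :: "nat \<Rightarrow> int" and G :: nat where
    "\<And>k. D k \<noteq> 0" "\<And>k. u k \<noteq> 0"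
    "\<And>k. of_int (D k) * g (1 / of_nat (N k)) = of_int (u k) * g (1 / of_nat b) + of_int (v k)"
    "\<And>k. \<bar>D k\<bar> \<le> int (N k) ^ G" "\<And>k. \<bar>u k\<bar> \<le> int (N k) ^ G" "\<And>k. \<bar>v k\<bar> \<le> int (N k) ^ G"
proof -
  have N2: "N k \<ge> 2" for k
  proof -
    have "b ^ 1 \<le> b ^ (d ^ k)" using b d by (intro power_increasing) auto
    then show ?thesis using b by (simp add: N_def)
  qed
  have Nb: "b \<le> N k" for k
    using b d power_increasing[of 1 "d ^ k" b] by (simp add: N_def)
  have NSuc: "N (Suc k) = N k ^ d" for k
    by (simp add: N_def mult.commute flip: power_mult)
  define e where "e = max (degree (B * C)) (max (degree B) (degree A))"
  define s where "s = (\<lambda>P :: int poly. \<Sum>i\<le>degree P. \<bar>coeff P i\<bar>)"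
  define L where "L = s (B * C) + s B + s A"
  have s0: "s P \<ge> 0" for P by (simp add: s_def sum_nonneg)
  have L0: "L \<ge> 0" using s0 by (simp add: L_def)
  \<comment> \<open>As \<open>N k\<close> is at least 2, the constant \<open>L\<close> is absorbed
    by \<open>N k ^ l\<close>, uniformly in \<open>k\<close>.\<close>
  define l where "l = nat L"
  have L: "L \<le> int (N k) ^ l" for k
  proof -
    have "int (nat L) \<le> int (2 ^ l)"
      unfolding l_def of_nat_le_iff by (rule less_imp_le[OF less_exp])
    also have "\<dots> \<le> int (N k) ^ l" using N2[of k] by (simp add: power_mono)
    finally show ?thesis using L0 by simp
  qed
  define E where "E = l + e"
  have scaled: "\<exists>z::nat \<Rightarrow> int. \<forall>k. of_int (z k) = of_nat (N k) ^ e * poly (map_poly of_int P) (1 / of_nat (N k) :: complex)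
      \<and> \<bar>z k\<bar> \<le> int (N k) ^ E" if "degree P \<le> e" "s P \<le> L" for P
  proof (rule choice, rule allI)
    fix k
    have "N k > 0" using N2[of k] by simp
    note scaled = int_poly_scaled[OF that(1) this]
    obtain z :: int where z: "of_int z = of_nat (N k) ^ e * poly (map_poly of_int P) (1 / of_nat (N k) :: complex)"
      "\<bar>z\<bar> \<le> s P * int (N k) ^ e"
      unfolding s_def by (rule scaled)
    have "s P * int (N k) ^ e \<le> int (N k) ^ l * int (N k) ^ e"
      using that(2) L[of k] by (intro mult_right_mono) auto
    then have "\<bar>z\<bar> \<le> int (N k) ^ E" using z(2) by (simp add: E_def power_add)
    then show "\<exists>z. of_int z = of_nat (N k) ^ e * poly (map_poly of_int P) (1 / of_nat (N k) :: complex)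
      \<and> \<bar>z\<bar> \<le> int (N k) ^ E" using z(1) by blast
  qed
  have deg: "degree (B * C) \<le> e" "degree B \<le> e" "degree A \<le> e" by (simp_all add: e_def le_max_iff_disj)
  have sL: "s (B * C) \<le> L" "s B \<le> L" "s A \<le> L"
    using s0[of A] s0[of B] s0[of "B * C"] by (simp_all add: L_def)
  obtain Y where Y: "\<And>k. of_int (Y k) = of_nat (N k) ^ e * poly (map_poly of_int (B * C)) (1 / of_nat (N k) :: complex)"
    "\<And>k. \<bar>Y k\<bar> \<le> int (N k) ^ E" using scaled[OF deg(1) sL(1)] by auto
  obtain U where U: "\<And>k. of_int (U k) = of_nat (N k) ^ e * poly (map_poly of_int B) (1 / of_nat (N k) :: complex)"
    "\<And>k. \<bar>U k\<bar> \<le> int (N k) ^ E" using scaled[OF deg(2) sL(2)] by auto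
  obtain V where V: "\<And>k. of_int (V k) = of_nat (N k) ^ e * poly (map_poly of_int A) (1 / of_nat (N k) :: complex)"
    "\<And>k. \<bar>V k\<bar> \<le> int (N k) ^ E" using scaled[OF deg(3) sL(3)] by auto
  have N0: "(of_nat (N k) :: complex) \<noteq> 0" for k using N2[of k] by auto
  have Y0: "Y k \<noteq> 0" for k
  proof
    assume "Y k = 0"
    then show False using Y(1)[of k] Bnz[of k] Cnz[of k] N0[of k] by (simp add: map_poly_of_int_mult)
  qed
  have U0: "U k \<noteq> 0" for k
  proof
    assume "U k = 0"
    then show False using U(1)[of k] Bnz[of k] N0[of k] by simp
  qed
  have step: "of_int (Y k) * g (1 / of_nat (N (Suc k))) = of_int (U k) * g (1 / of_nat (N k)) - of_int (V k)" for k
  proof -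
    have "norm (1 / of_nat (N k) :: complex) < 1" using N2[of k] by (simp add: norm_divide)
    from feq[OF this] show ?thesis
      by (simp add: Y(1) U(1) V(1) NSuc power_one_over mult.assoc flip: right_diff_distrib)
  qed
  define D where "D = (\<lambda>k. \<Prod>j<k. Y j)"
  define u where "u = (\<lambda>k. \<Prod>j<k. U j)"
  \<comment> \<open>The constant term of the relation after multiplying step \<open>k\<close> by
    \<open>D k\<close>.\<close>
  define v where "v = rec_nat 0 (\<lambda>k w. U k * w - V k * D k)"
  have v_Suc: "v 0 = 0" "v (Suc k) = U k * v k - V k * D k" for k by (simp_all add: v_def)
  have eq: "of_int (D k) * g (1 / of_nat (N k)) = of_int (u k) * g (1 / of_nat b) + of_int (v k)" for k
  proof (induction k)
    case 0
    then show ?case by (simp add: D_def u_def v_Suc N_def)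
  next
    case (Suc k)
    have "of_int (D (Suc k)) * g (1 / of_nat (N (Suc k))) = of_int (D k) * (of_int (Y k) * g (1 / of_nat (N (Suc k))))"
      by (simp add: D_def)
    also have "\<dots> = of_int (U k) * (of_int (D k) * g (1 / of_nat (N k))) - of_int (V k * D k)"
      by (simp add: step algebra_simps)
    also have "\<dots> = of_int (u (Suc k)) * g (1 / of_nat b) + of_int (v (Suc k))"
      by (simp add: Suc v_Suc u_def algebra_simps)
    finally show ?case .
  qed
  \<comment> \<open>The factor \<open>2 ^ k\<close> pays for the two summands in the recursion of
    \<open>v\<close>. The exponent \<open>E\<close> is preserved because squaring the bound at
    \<open>k\<close> costs at most the passage from \<open>N k\<close> to
    \<open>N k ^ d\<close>.\<close>
  have bound: "\<bar>D k\<bar> \<le> 2 ^ k * int (N k) ^ E \<and> \<bar>u k\<bar> \<le> 2 ^ k * int (N k) ^ E \<and> \<bar>v k\<bar> \<le> 2 ^ k * int (N k) ^ E" for k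
  proof (induction k)
    case 0
    have "1 \<le> int (N 0) ^ E" using N2[of 0] by simp
    then show ?case by (simp add: D_def u_def v_Suc)
  next
    case (Suc k)
    define X where "X = int (N k) ^ E"
    have X: "X \<ge> 1" using N2[of k] by (simp add: X_def)
    have XX: "X * X \<le> int (N (Suc k)) ^ E"
    proof -
      have "X * X = int (N k) ^ (2 * E)" by (simp add: X_def mult_2 power_add)
      also have "\<dots> \<le> int (N k) ^ (d * E)" using N2[of k] d by (intro power_increasing) auto
      finally show ?thesis by (simp add: NSuc power_mult)
    qed
    have IH: "\<bar>D k\<bar> \<le> 2 ^ k * X" "\<bar>u k\<bar> \<le> 2 ^ k * X" "\<bar>v k\<bar> \<le> 2 ^ k * X" using Suc by (simp_all add: X_def)
    have c: "\<bar>Y k\<bar> \<le> X" "\<bar>U k\<bar> \<le> X" "\<bar>V k\<bar> \<le> X" using Y U V by (simp_all add: X_def)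
    have p1: "\<bar>Y k * D k\<bar> \<le> X * (2 ^ k * X)" "\<bar>U k * u k\<bar> \<le> X * (2 ^ k * X)"
      "\<bar>U k * v k\<bar> \<le> X * (2 ^ k * X)" "\<bar>V k * D k\<bar> \<le> X * (2 ^ k * X)"
      using IH c by (intro int_mult_abs_mono; simp)+
    have "X * (2 ^ k * X) = 2 ^ k * (X * X)" by simp
    also have "\<dots> \<le> 2 ^ k * int (N (Suc k)) ^ E" using XX by (intro mult_left_mono) auto
    finally have p2: "X * (2 ^ k * X) \<le> 2 ^ k * int (N (Suc k)) ^ E" .
    have p0: "X * (2 ^ k * X) \<ge> 0" using X by simp
    have rec: "D (Suc k) = Y k * D k" "u (Suc k) = U k * u k" by (simp_all add: D_def u_def mult.commute)
    have two: "2 ^ Suc k * int (N (Suc k)) ^ E = 2 * (2 ^ k * int (N (Suc k)) ^ E)" by simp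
    show ?case unfolding rec v_Suc two using p0 p1 p2 by linarith
  qed
  have le: "2 ^ k * int (N k) ^ E \<le> int (N k) ^ Suc E" for k
  proof -
    have "k \<le> d ^ k" using less_exp[of k] power_mono[of 2 d k] d by simp
    then have "(2::nat) ^ k \<le> b ^ (d ^ k)"
      using b by (meson order_trans power_increasing power_mono one_le_numeral zero_le)
    then have "int (2 ^ k) \<le> int (N k)" unfolding N_def of_nat_le_iff .
    then show ?thesis by (simp add: mult_right_mono)
  qed
  show ?thesis
  proof (rule that[of D u v "Suc E"])
    show "D k \<noteq> 0" "u k \<noteq> 0" for k using Y0 U0 by (auto simp: D_def u_def)
    show "\<bar>D k\<bar> \<le> int (N k) ^ Suc E" "\<bar>u k\<bar> \<le> int (N k) ^ Suc E" "\<bar>v k\<bar> \<le> int (N k) ^ Suc E" for k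
      using bound[of k] le[of k] by linarith+
  qed (rule eq)
qed

section \<open>Transcendence\<close>

lemma fps_nth_of_int_power:
  "fps_nth (Abs_fps (\<lambda>n. of_int (c n)) ^ j) l = (of_int (fps_nth (Abs_fps c ^ j) l) :: complex)"
proof (induction j arbitrary: l)
  case (Suc j)
  then show ?case by (simp add: fps_mult_nth)
qed simp

text \<open>Put n = N k. Clearing denominators in E(1/n) gives an integer polynomial in
  \<open>\<xi>\<close> of degree at most p, height O(n^(p(G+1))) and absolute value O(n^(p(G+1) -
  p^2)). Liouville's inequality then bounds n^(p(G+1)(kappa+1) - p^2) from below by a positive
  constant, which fails for large n.\<close>

lemma mahler_transcendence:
  fixes c :: "nat \<Rightarrow> int" and \<xi> :: real and N :: "nat \<Rightarrow> nat" and D u v :: "nat \<Rightarrow> int"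
  defines "F \<equiv> Abs_fps (\<lambda>n. of_int (c n)) :: complex fps"
  assumes rad: "fps_conv_radius F \<ge> 1"
    and irr: "\<And>Q :: int poly. Q \<noteq> 0 \<Longrightarrow> infinite {l. fps_nth (fps_of_poly Q * Abs_fps c) l \<noteq> 0}"
    and N: "filterlim N at_top sequentially"
    and D0: "\<And>k. D k \<noteq> 0"
    and eq: "\<And>k. of_int (D k) * eval_fps F (1 / of_nat (N k)) = of_int (u k) * of_real \<xi> + of_int (v k)"
    and bd: "\<And>k. \<bar>D k\<bar> \<le> int (N k) ^ G" "\<And>k. \<bar>u k\<bar> \<le> int (N k) ^ G" "\<And>k. \<bar>v k\<bar> \<le> int (N k) ^ G"
  shows "\<not> algebraic \<xi>"
proof
  assume "algebraic \<xi>"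
  then obtain \<kappa> :: nat where \<kappa>: "\<forall>p. \<exists>c>0. \<forall>(F::nat \<Rightarrow> int) H. H \<ge> 1 \<longrightarrow> (\<forall>l\<le>p. \<bar>F l\<bar> \<le> H) \<longrightarrow>
     (\<Sum>l\<le>p. of_int (F l) * \<xi> ^ l) \<noteq> 0 \<longrightarrow>
     c \<le> \<bar>\<Sum>l\<le>p. of_int (F l) * \<xi> ^ l\<bar> * of_int H ^ \<kappa>"
    by (rule liouville_inequality[THEN exE])
  \<comment> \<open>One more than \<open>(G + 1) * (\<kappa> + 1)\<close>, so that the final
    exponent of n is exactly -p.\<close>
  define p where "p = Suc ((G + 1) * (\<kappa> + 1))"
  obtain c0 where c0: "c0 > 0" and liou: "\<And>(F::nat \<Rightarrow> int) H. H \<ge> 1 \<Longrightarrow> (\<And>l. l\<le>p \<Longrightarrow> \<bar>F l\<bar> \<le> H) \<Longrightarrow>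
     (\<Sum>l\<le>p. of_int (F l) * \<xi> ^ l) \<noteq> 0 \<Longrightarrow>
     c0 \<le> \<bar>\<Sum>l\<le>p. of_int (F l) * \<xi> ^ l\<bar> * of_int H ^ \<kappa>"
    using \<kappa>[rule_format, of p] by (elim exE conjE) (rule that, auto)
  define I where "I = {..p} \<times> {..p}"
  obtain x :: "nat \<times> nat \<Rightarrow> int" where x: "\<exists>ij\<in>I. x ij \<noteq> 0"
    "\<And>e. e < p * p \<Longrightarrow> (\<Sum>ij\<in>I. fps_nth (fps_X ^ fst ij * Abs_fps c ^ snd ij) e * x ij) = 0"
    using kernel_vector[of I "p * p" "\<lambda>e ij. fps_nth (fps_X ^ fst ij * Abs_fps c ^ snd ij) e"]
    by (auto simp: I_def card_cartesian_product)
  define Q where "Q = (\<lambda>j. \<Sum>i\<le>p. monom (x (i, j)) i)"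
  have cQ: "coeff (Q j) i = (if i \<le> p then x (i, j) else 0)" for i j
    by (simp add: Q_def coeff_sum if_distrib cong: if_cong)
  define A where "A = (\<lambda>j. map_poly of_int (Q j) :: complex poly)"
  have evA: "poly (A j) z = (\<Sum>i\<le>p. of_int (x (i, j)) * z ^ i)" for j z
  proof -
    have "degree (Q j) \<le> p" by (rule degree_le) (simp add: cQ)
    then have "(\<Sum>i\<le>degree (Q j). of_int (coeff (Q j) i) * z ^ i) = (\<Sum>i\<le>p. of_int (coeff (Q j) i) * z ^ i)"
      by (intro sum.mono_neutral_left) (auto simp: coeff_eq_0)
    then show ?thesis by (simp add: A_def poly_altdef degree_map_poly coeff_map_poly cQ)
  qed
  define E where "E = (\<Sum>j\<le>p. fps_of_poly (A j) * F ^ j)"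
  have E_nth: "fps_nth E e = of_int (\<Sum>ij\<in>I. fps_nth (fps_X ^ fst ij * Abs_fps c ^ snd ij) e * x ij)" for e
  proof -
    have "fps_nth E e = of_int (\<Sum>j\<le>p. fps_nth (fps_of_poly (Q j) * Abs_fps c ^ j) e)"
      by (simp add: E_def A_def F_def fps_sum_nth fps_mult_nth coeff_map_poly fps_nth_of_int_power)
    also have "(\<Sum>j\<le>p. fps_nth (fps_of_poly (Q j) * Abs_fps c ^ j) e) =
        (\<Sum>j\<le>p. \<Sum>i\<le>p. fps_nth (fps_X ^ i * Abs_fps c ^ j) e * x (i, j))"
    proof (intro sum.cong refl)
      fix j
      have "fps_of_poly (Q j) * Abs_fps c ^ j = (\<Sum>i\<le>p. fps_const (x (i, j)) * (fps_X ^ i * Abs_fps c ^ j))"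
        by (simp add: Q_def fps_of_poly_sum fps_of_poly_monom sum_distrib_right mult.assoc)
      then show "fps_nth (fps_of_poly (Q j) * Abs_fps c ^ j) e = (\<Sum>i\<le>p. fps_nth (fps_X ^ i * Abs_fps c ^ j) e * x (i, j))"
        by (simp add: fps_sum_nth mult.commute)
    qed
    also have "\<dots> = (\<Sum>ij\<in>I. fps_nth (fps_X ^ fst ij * Abs_fps c ^ snd ij) e * x ij)"
      unfolding I_def by (subst sum.swap) (simp add: sum.cartesian_product split_def)
    finally show ?thesis .
  qed
  \<comment> \<open>If \<open>E\<close> were zero, f would be algebraic over the polynomials. With
    \<open>J\<close> the last index for which \<open>Q J\<close> is nonzero, \<open>A J\<close>
    times f would then be a polynomial, contrary to \<open>irr\<close>.\<close>
  have E0: "E \<noteq> 0"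
  proof
    assume "E = 0"
    define S where "S = {j. j \<le> p \<and> Q j \<noteq> 0}"
    have "finite S" by (rule finite_subset[of _ "{..p}"]) (auto simp: S_def)
    moreover have "S \<noteq> {}"
    proof -
      obtain i j where "i \<le> p" "j \<le> p" "x (i, j) \<noteq> 0" using x(1) by (auto simp: I_def)
      then have "coeff (Q j) i \<noteq> 0" by (simp add: cQ)
      then show ?thesis using \<open>j \<le> p\<close> by (auto simp: S_def)
    qed
    ultimately have J: "Max S \<in> S" and Jmax: "\<And>j. j \<in> S \<Longrightarrow> j \<le> Max S" by auto
    define J where "J = Max S"
    have Jp: "J \<le> p" and QJ: "Q J \<noteq> 0" using J by (auto simp: J_def S_def)
    have "Q j = 0" if "j \<le> p" "\<not> j \<le> J" for j
    proof (rule ccontr)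
      assume "Q j \<noteq> 0"
      then have "j \<in> S" using that by (simp add: S_def)
      from Jmax[OF this] show False using that by (simp add: J_def)
    qed
    then have "(\<Sum>j\<le>J. fps_of_poly (A j) * F ^ j) = E" unfolding E_def
      using Jp by (intro sum.mono_neutral_left) (auto simp: A_def)
    then have "finite {i. fps_nth (fps_of_poly (A J) * F) i \<noteq> 0}"
      using \<open>E = 0\<close> QJ by (intro algebraic_fps_finite_support[OF rad])
        (auto simp: F_def A_def coeff_map_poly poly_eq_iff)
    then show False using irr[OF QJ] unfolding A_def F_def fps_nth_of_int_mult by simp
  qed
  define M where "M = subdegree E"
  have Mp: "p * p \<le> M" unfolding M_def
    by (rule subdegree_geI[OF E0]) (simp add: E_nth x(2))
  have radE: "fps_conv_radius E \<ge> 1" unfolding E_def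
    using rad by (intro fps_conv_radius_sum_ge fps_conv_radius_mult_ge fps_conv_radius_power_ge) auto
  have "fps_conv_radius E > 0" using radE by (auto intro: less_le_trans[of 0 1])
  then obtain c1 K where c1: "c1 > 0" "K > 0" and near:
    "\<forall>\<^sub>F z in nhds 0. c1 * norm z ^ M \<le> norm (eval_fps E z) \<and> norm (eval_fps E z) \<le> K * norm z ^ M"
    using eval_fps_near_0[OF _ E0] unfolding M_def by blast
  have Nreal: "filterlim (\<lambda>k. real (N k)) at_top sequentially"
    using filterlim_compose[OF filterlim_real_sequentially N] .
  have "(\<lambda>k. 1 / of_nat (N k) :: complex) \<longlonglongrightarrow> 0"
    using filterlim_compose[OF tendsto_inverse_0_at_top[OF filterlim_real_sequentially] N]
    by (subst tendsto_norm_zero_iff[symmetric]) (simp add: norm_divide inverse_eq_divide)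
  then have ev1: "\<forall>\<^sub>F k in sequentially. c1 * norm (1 / of_nat (N k) :: complex) ^ M \<le> norm (eval_fps E (1 / of_nat (N k)))
     \<and> norm (eval_fps E (1 / of_nat (N k))) \<le> K * norm (1 / of_nat (N k) :: complex) ^ M"
    using near by (rule eventually_compose_filterlim[rotated])
  \<comment> \<open>A height constant independent of \<open>k\<close>; \<open>2 ^ p\<close> bounds
    the binomial coefficients that appear when (u \<open>\<xi>\<close> + v)^j is expanded.\<close>
  define S where "S = 1 + (\<Sum>i\<le>p. \<Sum>j\<le>p. \<bar>x (i, j)\<bar> * 2 ^ p)"
  have S1: "S \<ge> 1" by (simp add: S_def sum_nonneg)
  have ev2: "\<forall>\<^sub>F k in sequentially. real (N k) > K * of_int S ^ \<kappa> / c0"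
    using Nreal by (simp add: filterlim_at_top_dense)
  have ev3: "\<forall>\<^sub>F k in sequentially. real (N k) > 1"
    using Nreal unfolding filterlim_at_top_dense by (rule spec)
  obtain k where k: "c1 * norm (1 / of_nat (N k) :: complex) ^ M \<le> norm (eval_fps E (1 / of_nat (N k)))"
     "norm (eval_fps E (1 / of_nat (N k))) \<le> K * norm (1 / of_nat (N k) :: complex) ^ M"
     "real (N k) > K * of_int S ^ \<kappa> / c0" "real (N k) > 1"
    using eventually_happens'[OF _ eventually_conj[OF ev1 eventually_conj[OF ev2 ev3]]] by auto
  define n where "n = int (N k)"
  have n1: "n > 1" using k(4) by (simp add: n_def)
  define z :: complex where "z = 1 / of_nat (N k)"
  have nz: "of_int n * z = 1" using n1 by (simp add: z_def n_def)
  have znorm: "norm z = 1 / of_int n" by (simp add: z_def n_def norm_divide)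
  have z1: "norm z < 1" using n1 by (simp add: znorm)
  define w where "w = eval_fps F z"
  have Dw: "of_int (D k) * w = of_int (u k) * of_real \<xi> + of_int (v k)"
    using eq[of k] by (simp add: w_def z_def)
  have zF: "norm z < fps_conv_radius F" using z1 rad by (metis ereal_less(3) less_le_trans)
  have evE: "eval_fps E z = (\<Sum>j\<le>p. \<Sum>i\<le>p. of_int (x (i, j)) * z ^ i * w ^ j)"
  proof -
    have evj: "eval_fps (fps_of_poly (A j) * F ^ j) z = (\<Sum>i\<le>p. of_int (x (i, j)) * z ^ i * w ^ j)" for j
    proof -
      have "norm z < fps_conv_radius (F ^ j)" using zF fps_conv_radius_power by (rule less_le_trans)
      then show ?thesis
        by (subst eval_fps_mult) (auto simp: eval_fps_power zF w_def evA sum_distrib_right)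
    qed
    show ?thesis unfolding E_def
      using rad z1 by (subst eval_fps_sum[where r = 1])
        (auto simp: evj one_ereal_def[symmetric] intro!: fps_conv_radius_mult_ge fps_conv_radius_power_ge)
  qed
  \<comment> \<open>The coefficient of \<open>\<xi> ^ l\<close> after multiplication by
    \<open>n ^ p * D k ^ p\<close>: the first factor clears z = 1/n, the second clears f(z) = (u
    \<open>\<xi>\<close> + v) / D.\<close>
  define a where "a = (\<lambda>l. \<Sum>j\<le>p. \<Sum>i\<le>p. x (i, j) * n ^ (p - i) * (D k ^ (p - j) * (int (j choose l) * u k ^ l * v k ^ (j - l))))"
  define X where "X = (\<Sum>l\<le>p. of_int (a l) * \<xi> ^ l)"
  have X_eq: "complex_of_real X = of_int n ^ p * of_int (D k) ^ p * eval_fps E z"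
  proof -
    have pow: "of_int n ^ p * z ^ i = of_int n ^ (p - i)" if "i \<le> p" for i
    proof -
      have "of_int n ^ p * z ^ i = of_int n ^ (p - i) * (of_int n * z) ^ i"
        using that by (simp add: power_mult_distrib flip: power_add mult.assoc)
      then show ?thesis by (simp add: nz)
    qed
    have powD: "of_int (D k) ^ p * w ^ j = (\<Sum>l\<le>p. of_int (D k ^ (p - j) * (int (j choose l) * u k ^ l * v k ^ (j - l))) * of_real \<xi> ^ l)"
      if "j \<le> p" for j
    proof -
      have "of_int (D k) ^ p * w ^ j = of_int (D k) ^ (p - j) * (of_int (D k) * w) ^ j"
        using that by (simp add: power_mult_distrib flip: power_add mult.assoc)
      also have "(of_int (D k) * w) ^ j = (\<Sum>l\<le>j. of_nat (j choose l) * (of_int (u k) * of_real \<xi>) ^ l * of_int (v k) ^ (j - l))"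
        unfolding Dw by (rule binomial_ring)
      also have "\<dots> = (\<Sum>l\<le>p. of_nat (j choose l) * (of_int (u k) * of_real \<xi>) ^ l * of_int (v k) ^ (j - l))"
        using that by (intro sum.mono_neutral_left) (auto simp: binomial_eq_0)
      finally show ?thesis
        by (simp add: sum_distrib_left power_mult_distrib mult_ac)
    qed
    have "of_int n ^ p * of_int (D k) ^ p * eval_fps E z =
       (\<Sum>j\<le>p. \<Sum>i\<le>p. of_int (x (i, j)) * (of_int n ^ p * z ^ i) * (of_int (D k) ^ p * w ^ j))"
      by (simp add: evE sum_distrib_left mult_ac)
    also have "\<dots> = (\<Sum>j\<le>p. \<Sum>i\<le>p. \<Sum>l\<le>p. of_int (x (i, j) * n ^ (p - i) * (D k ^ (p - j) * (int (j choose l) * u k ^ l * v k ^ (j - l)))) * of_real \<xi> ^ l)"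
    proof (intro sum.cong refl)
      fix j i assume "j \<in> {..p}" "i \<in> {..p}"
      then have "j \<le> p" "i \<le> p" by simp_all
      then show "of_int (x (i, j)) * (of_int n ^ p * z ^ i) * (of_int (D k) ^ p * w ^ j) =
        (\<Sum>l\<le>p. of_int (x (i, j) * n ^ (p - i) * (D k ^ (p - j) * (int (j choose l) * u k ^ l * v k ^ (j - l)))) * of_real \<xi> ^ l)"
        unfolding pow[OF \<open>i \<le> p\<close>] powD[OF \<open>j \<le> p\<close>] by (simp add: sum_distrib_left mult_ac)
    qed
    also have "\<dots> = (\<Sum>j\<le>p. \<Sum>l\<le>p. \<Sum>i\<le>p. of_int (x (i, j) * n ^ (p - i) * (D k ^ (p - j) * (int (j choose l) * u k ^ l * v k ^ (j - l)))) * of_real \<xi> ^ l)"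
      by (intro sum.cong refl sum.swap)
    also have "\<dots> = (\<Sum>l\<le>p. \<Sum>j\<le>p. \<Sum>i\<le>p. of_int (x (i, j) * n ^ (p - i) * (D k ^ (p - j) * (int (j choose l) * u k ^ l * v k ^ (j - l)))) * of_real \<xi> ^ l)"
      by (rule sum.swap)
    also have "\<dots> = complex_of_real X"
      by (simp add: X_def a_def sum_distrib_right)
    finally show ?thesis by simp
  qed
  define W where "W = n ^ G"
  have W1: "W \<ge> 1" using n1 by (simp add: W_def)
  have bdW: "\<bar>D k\<bar> \<le> W" "\<bar>u k\<bar> \<le> W" "\<bar>v k\<bar> \<le> W" using bd[of k] by (simp_all add: W_def n_def)
  have absX: "\<bar>X\<bar> = of_int n ^ p * of_int \<bar>D k\<bar> ^ p * norm (eval_fps E z)"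
    using arg_cong[OF X_eq, of norm] n1 by (simp add: norm_mult norm_power)
  \<comment> \<open>No zero estimate is required: near 0, the nonzero series \<open>E\<close> is
    bounded below by \<open>c1 * norm z ^ M\<close>.\<close>
  have X0: "X \<noteq> 0"
  proof -
    have "0 < c1 * norm z ^ M" using c1 n1 by (simp add: znorm)
    also have "\<dots> \<le> norm (eval_fps E z)" using k(1) by (simp add: z_def)
    finally show ?thesis using X_eq n1 D0[of k] by auto
  qed
  have absX_le: "\<bar>X\<bar> \<le> of_int n ^ p * of_int W ^ p * (K / of_int n ^ (p * p))"
  proof -
    have "norm (eval_fps E z) \<le> K * norm z ^ M" using k(2) by (simp add: z_def)
    also have "\<dots> \<le> K * norm z ^ (p * p)"
      using c1 z1 Mp by (intro mult_left_mono power_decreasing) auto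
    also have "\<dots> = K / of_int n ^ (p * p)" by (simp add: znorm power_one_over)
    finally have 1: "norm (eval_fps E z) \<le> K / of_int n ^ (p * p)" .
    have "real_of_int \<bar>D k\<bar> ^ p \<le> of_int W ^ p"
      using bdW(1) by (intro power_mono) (simp_all only: of_int_le_iff of_int_0_le_iff abs_ge_zero)
    then show ?thesis unfolding absX using 1 n1 W1 by (intro mult_mono) auto
  qed
  define H where "H = S * (n ^ p * W ^ p)"
  have "H > 0"
    unfolding H_def using S1 n1 W1 by (intro mult_pos_pos zero_less_power) linarith+
  then have H1: "H \<ge> 1" by linarith
  have aH: "\<bar>a l\<bar> \<le> H" if "l \<le> p" for l
  proof -
    have summand: "\<bar>x (i, j) * n ^ (p - i) * (D k ^ (p - j) * (int (j choose l) * u k ^ l * v k ^ (j - l)))\<bar>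
        \<le> \<bar>x (i, j)\<bar> * 2 ^ p * (n ^ p * W ^ p)" if "i \<le> p" "j \<le> p" for i j
    proof (cases "l \<le> j")
      case True
      have "int (j choose l) \<le> 2 ^ p"
      proof -
        have "j choose l \<le> 2 ^ j" by (rule binomial_le_pow2)
        also have "\<dots> \<le> 2 ^ p" using that by (simp add: power_increasing)
        finally show ?thesis by (metis of_nat_le_iff of_nat_numeral of_nat_power)
      qed
      moreover have "n ^ (p - i) \<le> n ^ p" using n1 by (simp add: power_increasing)
      moreover have "\<bar>D k\<bar> ^ (p - j) \<le> W ^ (p - j)" "\<bar>u k\<bar> ^ l \<le> W ^ l" "\<bar>v k\<bar> ^ (j - l) \<le> W ^ (j - l)"
        using bdW by (simp_all add: power_mono)
      ultimately have "\<bar>x (i, j) * n ^ (p - i) * (D k ^ (p - j) * (int (j choose l) * u k ^ l * v k ^ (j - l)))\<bar>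
          \<le> \<bar>x (i, j)\<bar> * n ^ p * (W ^ (p - j) * (2 ^ p * W ^ l * W ^ (j - l)))"
        unfolding abs_mult power_abs using n1 W1 by (intro mult_mono) auto
      also have "\<dots> = \<bar>x (i, j)\<bar> * 2 ^ p * (n ^ p * W ^ (p - j + l + (j - l)))"
        by (simp add: power_add mult_ac)
      also have "p - j + l + (j - l) = p" using that True by simp
      finally show ?thesis .
    next
      case False
      then show ?thesis using n1 W1 by (simp add: binomial_eq_0)
    qed
    have "\<bar>a l\<bar> \<le> (\<Sum>j\<le>p. \<Sum>i\<le>p. \<bar>x (i, j) * n ^ (p - i) * (D k ^ (p - j) * (int (j choose l) * u k ^ l * v k ^ (j - l)))\<bar>)"
      unfolding a_def by (intro order_trans[OF sum_abs] sum_mono sum_abs)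
    also have "\<dots> \<le> (\<Sum>j\<le>p. \<Sum>i\<le>p. \<bar>x (i, j)\<bar> * 2 ^ p * (n ^ p * W ^ p))"
      by (intro sum_mono summand) auto
    also have "\<dots> = (S - 1) * (n ^ p * W ^ p)"
      unfolding S_def by (subst sum.swap) (simp add: sum_distrib_right)
    also have "\<dots> \<le> H" unfolding H_def using n1 W1 by (intro mult_right_mono) auto
    finally show ?thesis .
  qed
  have "c0 \<le> \<bar>X\<bar> * of_int H ^ \<kappa>"
    using liou[OF H1 aH] X0 by (simp add: X_def)
  also have "\<dots> \<le> of_int n ^ p * of_int W ^ p * (K / of_int n ^ (p * p)) * of_int H ^ \<kappa>"
    using absX_le H1 by (intro mult_right_mono) auto
  also have "\<dots> = K * of_int S ^ \<kappa> * (of_int n ^ (p * ((G + 1) * (\<kappa> + 1))) / of_int n ^ (p * p))"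
    by (simp add: H_def W_def power_mult_distrib power_mult[symmetric] power_add[symmetric] algebra_simps)
  also have "of_int n ^ (p * p) = (of_int n ^ (p * ((G + 1) * (\<kappa> + 1))) * of_int n ^ p :: real)"
  proof -
    have pp: "p * p = p * ((G + 1) * (\<kappa> + 1)) + p"
      by (subst (2) p_def) simp
    show ?thesis unfolding pp by (rule power_add)
  qed
  also have "of_int n ^ (p * ((G + 1) * (\<kappa> + 1))) / (of_int n ^ (p * ((G + 1) * (\<kappa> + 1))) * of_int n ^ p) = (1 / of_int n ^ p :: real)"
    using n1 by simp
  also have "K * of_int S ^ \<kappa> * (1 / of_int n ^ p) \<le> K * of_int S ^ \<kappa> * (1 / of_int n)"
  proof -
    have "real_of_int n ^ 1 \<le> of_int n ^ p" using n1 by (intro power_increasing) (auto simp: p_def)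
    then show ?thesis using n1 c1 S1 by (intro mult_left_mono divide_left_mono) auto
  qed
  also have "\<dots> < c0"
    using k(3) c0 n1 by (simp add: n_def field_simps)
  finally show False by simp
qed

section \<open>Approximations from Hankel determinants\<close>

text \<open>Substituting the affine relation for f(1/N k) into the Pade remainder R = Q f - P at z =
  1/N k gives the exact identity (\<open>\<xi>\<close> - p/q) u Q(z) = D R(z). Here Q(z) stays away
  from 0 because Q(0) is a nonzero integer. All constants depend on \<open>n\<close>, hence the
  claim only for large \<open>k\<close>.\<close>

lemma hankel_approximants:
  fixes c :: "nat \<Rightarrow> int" and \<xi> :: real and N :: "nat \<Rightarrow> nat" and D u v :: "nat \<Rightarrow> int"
  defines "F \<equiv> Abs_fps (\<lambda>n. of_int (c n)) :: complex fps"
  assumes rad: "fps_conv_radius F \<ge> 1"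
    and N: "filterlim N at_top sequentially"
    and D0: "\<And>k. D k \<noteq> 0" and u0: "\<And>k. u k \<noteq> 0"
    and eq: "\<And>k. of_int (D k) * eval_fps F (1 / of_nat (N k)) = of_int (u k) * of_real \<xi> + of_int (v k)"
    and bd: "\<And>k. \<bar>D k\<bar> \<le> int (N k) ^ G" "\<And>k. \<bar>u k\<bar> \<le> int (N k) ^ G"
    and det: "hankel_det c n \<noteq> 0" and det': "hankel_det c n' \<noteq> 0" and nn': "n < n'"
  shows "\<forall>\<^sub>F k in sequentially. \<exists>p q :: int. q \<noteq> 0 \<and> \<bar>real_of_int q\<bar> \<le> real (N k) ^ (n + Suc G) \<and>
     1 / real (N k) ^ (n + n' + Suc G) \<le> \<bar>\<xi> - of_int p / of_int q\<bar> \<and>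
     \<bar>\<xi> - of_int p / of_int q\<bar> \<le> real (N k) ^ Suc G / real (N k) ^ (2 * n)"
proof -
  obtain Q P :: "int poly" and M where Q0: "coeff Q 0 \<noteq> 0" and deg: "degree Q \<le> n" "degree P \<le> n"
    and M: "2 * n \<le> M" "M < n + n'"
    and R: "fps_of_poly (map_poly of_int Q) * F - fps_of_poly (map_poly of_int P) \<noteq> (0 :: complex fps)"
      "subdegree (fps_of_poly (map_poly of_int Q) * F - fps_of_poly (map_poly of_int P)) = M"
    unfolding F_def by (rule pade_approximant[OF det det' nn'])
  define R where "R = fps_of_poly (map_poly of_int Q) * F - fps_of_poly (map_poly of_int P)"
  have radR: "fps_conv_radius R \<ge> 1" unfolding R_def
    using rad by (intro fps_conv_radius_diff_ge fps_conv_radius_mult_ge) auto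
  then have radR0: "fps_conv_radius R > 0" by (auto intro: less_le_trans[of 0 1])
  have R0: "R \<noteq> 0" and subR: "subdegree R = M" using R unfolding R_def by blast+
  obtain c1 K where c1: "c1 > 0" "K > 0" and near:
    "\<forall>\<^sub>F z in nhds 0. c1 * norm z ^ M \<le> norm (eval_fps R z) \<and> norm (eval_fps R z) \<le> K * norm z ^ M"
    by (rule eval_fps_near_0[OF radR0 R0, unfolded subR])
  define f where "f = poly (map_poly of_int Q :: complex poly)"
  have "isCont f 0" unfolding f_def by (intro continuous_intros)
  then have "(f \<longlongrightarrow> f 0) (nhds 0)" by (simp add: isCont_def tendsto_nhds_iff)
  then have lim: "((\<lambda>z. norm (f z)) \<longlongrightarrow> norm (f 0)) (nhds 0)" by (rule tendsto_norm)
  have "f 0 = of_int (coeff Q 0)" by (simp add: f_def poly_0_coeff_0 coeff_map_poly)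
  moreover have "\<bar>coeff Q 0\<bar> \<ge> 1" using Q0 by linarith
  ultimately have f0: "norm (f 0) \<ge> 1" by (simp add: norm_of_int flip: of_int_abs)
  have fhalf: "\<forall>\<^sub>F z in nhds 0. norm (f z) > 1 / 2"
    by (rule order_tendstoD(1)[OF lim]) (use f0 in linarith)
  define s where "s = (\<Sum>i\<le>degree Q. \<bar>coeff Q i\<bar>)"
  define s' where "s' = (\<Sum>i\<le>degree (map_poly of_int Q :: complex poly). norm (coeff (map_poly of_int Q :: complex poly) i))"
  have s'0: "s' \<ge> 0" by (simp add: s'_def sum_nonneg)
  have Nreal: "filterlim (\<lambda>k. real (N k)) at_top sequentially"
    using filterlim_compose[OF filterlim_real_sequentially N] .
  have to0: "(\<lambda>k. 1 / of_nat (N k) :: complex) \<longlonglongrightarrow> 0"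
    using filterlim_compose[OF tendsto_inverse_0_at_top[OF filterlim_real_sequentially] N]
    by (subst tendsto_norm_zero_iff[symmetric]) (simp add: norm_divide inverse_eq_divide)
  have big: "\<forall>\<^sub>F k in sequentially. real (N k) > Z" for Z
    using Nreal unfolding filterlim_at_top_dense by (rule spec)
  have "\<forall>\<^sub>F k in sequentially. c1 * norm (1 / of_nat (N k) :: complex) ^ M \<le> norm (eval_fps R (1 / of_nat (N k)))
     \<and> norm (eval_fps R (1 / of_nat (N k))) \<le> K * norm (1 / of_nat (N k) :: complex) ^ M"
    using near to0 by (rule eventually_compose_filterlim)
  moreover have "\<forall>\<^sub>F k in sequentially. norm (f (1 / of_nat (N k))) > 1 / 2"
    using fhalf to0 by (rule eventually_compose_filterlim)
  \<comment> \<open>The extra factor \<open>N k\<close> in the exponent \<open>Suc G\<close> absorbs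
    one constant per estimate: \<open>s\<close> in the size of q, \<open>2 * K\<close> in the upper
    and \<open>s' / c1\<close> in the lower bound of the error.\<close>
  ultimately show ?thesis
    using big[of 1] big[of "2 * K"] big[of "s' / c1"] big[of "of_int s"]
  proof eventually_elim
    case (elim k)
    define m where "m = real (N k)"
    define z :: complex where "z = 1 / of_nat (N k)"
    have m1: "m > 1" using elim by (simp add: m_def)
    then have N0: "N k > 0" by (simp add: m_def)
    have znorm: "norm z = 1 / m" by (simp add: z_def m_def norm_divide)
    have z1: "norm z < 1" using m1 by (simp add: znorm)
    have zF: "norm z < fps_conv_radius F" using z1 rad by (metis ereal_less(3) less_le_trans)
    define w where "w = eval_fps F z"
    have Rz: "eval_fps R z = f z * w - poly (map_poly of_int P) z"
    proof -
      have "1 \<le> fps_conv_radius (fps_of_poly (map_poly of_int Q) * F)"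
        using rad by (intro fps_conv_radius_mult_ge) auto
      then have "norm z < fps_conv_radius (fps_of_poly (map_poly of_int Q) * F)"
        using z1 by (metis ereal_less(3) less_le_trans)
      then show ?thesis unfolding R_def by (subst eval_fps_diff) (auto simp: eval_fps_mult zF f_def w_def)
    qed
    obtain zQ :: int where zQ: "of_int zQ = of_nat (N k) ^ n * f z" "\<bar>zQ\<bar> \<le> s * int (N k) ^ n"
      unfolding f_def s_def z_def by (rule int_poly_scaled[OF deg(1) N0])
    obtain zP :: int where zP: "of_int zP = of_nat (N k) ^ n * poly (map_poly of_int P) z"
      unfolding z_def by (rule int_poly_scaled[OF deg(2) N0])
    have fz: "norm (f z) > 1 / 2" using elim by (simp add: z_def)
    then have fz0: "f z \<noteq> 0" by auto
    have zQ0: "zQ \<noteq> 0" using zQ(1) fz0 N0 by auto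
    define q where "q = u k * zQ"
    define p where "p = D k * zP - v k * zQ"
    have q0: "q \<noteq> 0" using u0 zQ0 by (simp add: q_def)
    have uc: "(of_int (u k) :: complex) \<noteq> 0" using u0 by simp
    have \<xi>: "of_int (D k) * w - of_int (v k) = of_int (u k) * complex_of_real \<xi>"
      using eq[of k] by (simp add: w_def z_def)
    have Nc: "(of_nat (N k) :: complex) \<noteq> 0" using N0 by simp
    have "complex_of_real (\<xi> - of_int p / of_int q) * (of_int (u k) * of_int zQ) =
        (of_int (u k) * complex_of_real \<xi>) * of_int zQ - of_int p"
      using uc zQ0 by (simp add: q_def field_simps)
    also have "\<dots> = of_int (D k) * (of_nat (N k) ^ n * eval_fps R z)"
      unfolding \<xi>[symmetric] by (simp add: p_def Rz zP zQ(1) algebra_simps)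
    finally have "complex_of_real (\<xi> - of_int p / of_int q) * (of_int (u k) * f z) = of_int (D k) * eval_fps R z"
      using Nc by (simp add: zQ(1))
    from arg_cong[OF this, of norm]
    have err: "\<bar>\<xi> - of_int p / of_int q\<bar> * (\<bar>of_int (u k)\<bar> * norm (f z)) = \<bar>of_int (D k)\<bar> * norm (eval_fps R z)"
      by (simp add: norm_mult del: of_real_diff of_real_divide)
    define e where "e = \<bar>\<xi> - of_int p / of_int q\<bar>"
    have e0: "e \<ge> 0" by (simp add: e_def)
    have ge1: "\<bar>real_of_int a\<bar> \<ge> 1" if "a \<noteq> 0" for a using that by linarith
    have of_int_bd: "\<bar>real_of_int a\<bar> \<le> m ^ G" if "\<bar>a\<bar> \<le> int (N k) ^ G" for a
    proof -
      have "real_of_int \<bar>a\<bar> \<le> real_of_int (int (N k) ^ G)" using that by (simp only: of_int_le_iff)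
      then show ?thesis by (simp add: m_def)
    qed
    have Rlo: "c1 / m ^ M \<le> norm (eval_fps R z)" and Rhi: "norm (eval_fps R z) \<le> K / m ^ M"
      using elim znorm by (simp_all add: z_def power_one_over m_def)
    have "\<bar>of_int q\<bar> \<le> m ^ (n + Suc G)"
    proof -
      have "\<bar>real_of_int zQ\<bar> \<le> of_int (s * int (N k) ^ n)"
        using zQ(2) by (simp only: of_int_abs[symmetric] of_int_le_iff)
      also have "\<dots> \<le> m * m ^ n" using elim by (simp add: m_def mult_right_mono)
      finally have "\<bar>real_of_int q\<bar> \<le> m ^ G * (m * m ^ n)"
        unfolding q_def of_int_mult abs_mult using of_int_bd[OF bd(2)] m1 by (intro mult_mono) auto
      then show ?thesis by (simp add: power_add mult_ac)
    qed
    moreover have "e \<le> m ^ Suc G / m ^ (2 * n)"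
    proof -
      have "e * (1 * (1 / 2)) \<le> e * (\<bar>of_int (u k)\<bar> * norm (f z))"
        using ge1[OF u0] fz e0 by (intro mult_left_mono mult_mono) auto
      also have "\<dots> \<le> m ^ G * (K / m ^ M)"
        unfolding e_def err using of_int_bd[OF bd(1)] Rhi m1 by (intro mult_mono) auto
      also have "\<dots> \<le> m ^ G * (K / m ^ (2 * n))"
        using m1 c1 M by (intro mult_left_mono divide_left_mono power_increasing) auto
      finally have "e \<le> (2 * K) * (m ^ G / m ^ (2 * n))" by (simp add: mult_ac)
      also have "\<dots> \<le> m * (m ^ G / m ^ (2 * n))" using elim m1 by (intro mult_right_mono) (auto simp: m_def)
      finally show ?thesis by simp
    qed
    moreover have "1 / m ^ (n + n' + Suc G) \<le> e"
    proof -
      have fs': "norm (f z) \<le> s'" unfolding f_def s'_def using z1 by (intro norm_poly_le) simp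
      have s'm: "s' \<le> c1 * m" using elim c1 by (simp add: m_def field_simps)
      have "1 * (c1 / m ^ (n + n')) \<le> \<bar>of_int (D k)\<bar> * norm (eval_fps R z)"
      proof (intro mult_mono)
        have "c1 / m ^ (n + n') \<le> c1 / m ^ M"
          using m1 c1 M by (intro divide_left_mono power_increasing) auto
        then show "c1 / m ^ (n + n') \<le> norm (eval_fps R z)" using Rlo by linarith
      qed (use ge1[OF D0] c1 m1 in auto)
      also have "\<dots> = e * (\<bar>of_int (u k)\<bar> * norm (f z))" by (simp add: e_def err)
      also have "\<dots> \<le> e * (m ^ G * (c1 * m))"
        using of_int_bd[OF bd(2)] fs' s'm e0 m1 by (intro mult_left_mono mult_mono) auto
      finally show ?thesis using c1 m1 by (simp add: field_simps power_add)
    qed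
    ultimately show ?case using q0 unfolding e_def m_def by blast
  qed
qed

section \<open>Irrationality exponent\<close>

text \<open>Choose \<open>k\<close> with n_i0 d^k <= x < n_i0 d^(k+1). Since n_i1 >= d n_i0, moving
  \<open>i\<close> from \<open>i0\<close> towards \<open>i1\<close> passes x, and each step
  multiplies by at most 1 + \<open>\<epsilon>\<close>. That \<open>i\<close> remains in a fixed
  finite window is essential for uniformity.\<close>

lemma multiplicatively_dense:
  fixes n :: "nat \<Rightarrow> nat" and x \<epsilon> :: real
  assumes d: "d \<ge> 2" and growth: "\<And>i. i0 \<le> i \<Longrightarrow> real (n (Suc i)) \<le> (1 + \<epsilon>) * real (n i)"
    and i1: "i0 \<le> i1" "d * n i0 \<le> n i1" and n0: "n i0 > 0" and x: "real (n i0 * d ^ K) \<le> x"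
  obtains i k where "i0 \<le> i" "i \<le> i1" "K \<le> k" "real (n i * d ^ k) \<le> x" "x < (1 + \<epsilon>) * real (n i * d ^ k)"
proof -
  have ex: "\<exists>j. x < real (n i0 * d ^ j)"
  proof -
    define j where "j = nat \<lceil>x\<rceil>"
    have "x \<le> real j" unfolding j_def by linarith
    also have "j < d ^ j" using less_exp[of j] power_mono[of 2 d j] d by linarith
    also have "d ^ j \<le> n i0 * d ^ j" using n0 by simp
    finally show ?thesis by auto
  qed
  define j where "j = (LEAST j. x < real (n i0 * d ^ j))"
  have j: "x < real (n i0 * d ^ j)" unfolding j_def using ex by (rule LeastI_ex)
  have "K < j"
  proof (rule ccontr)
    assume "\<not> K < j"
    then have "n i0 * d ^ j \<le> n i0 * d ^ K" using d by (intro mult_left_mono power_increasing) auto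
    then show False using j x by linarith
  qed
  then obtain k where k: "j = Suc k" "K \<le> k" by (cases j) auto
  have lo: "real (n i0 * d ^ k) \<le> x"
    using not_less_Least[of k "\<lambda>j. x < real (n i0 * d ^ j)"] k(1) unfolding j_def[symmetric] by (simp add: not_less)
  define good where "good = (\<lambda>i. i0 \<le> i \<and> x < real (n i * d ^ k))"
  have "good i1"
  proof -
    have "n i0 * d ^ j \<le> n i1 * d ^ k" using i1(2) by (simp add: k mult_ac)
    then show ?thesis using j i1(1) unfolding good_def by linarith
  qed
  define i' where "i' = (LEAST i. good i)"
  have i': "good i'" unfolding i'_def using \<open>good i1\<close> by (rule LeastI)
  have i'_le: "i' \<le> i1" unfolding i'_def using \<open>good i1\<close> by (rule Least_le)
  have "i' \<noteq> i0" using i' lo by (auto simp: good_def)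
  then obtain i where i: "i' = Suc i" "i0 \<le> i" using i' by (cases i') (auto simp: good_def)
  have "\<not> good i" using not_less_Least[of i good] i(1) unfolding i'_def by simp
  then have "real (n i * d ^ k) \<le> x" using i(2) by (simp add: good_def)
  moreover have "x < (1 + \<epsilon>) * real (n i * d ^ k)"
  proof -
    have "x < real (n (Suc i)) * real (d ^ k)" using i' i(1) by (simp add: good_def)
    also have "\<dots> \<le> ((1 + \<epsilon>) * real (n i)) * real (d ^ k)" using growth[OF i(2)] by (intro mult_right_mono) auto
    finally show ?thesis by (simp add: mult_ac)
  qed
  ultimately show ?thesis using that[of i k] i i'_le k(2) by simp
qed

text \<open>Two distinct fractions differ by at least 1/(q q'). If p'/q' is closer to
  \<open>\<xi>\<close> than half this distance, then p/q is at least the other half away. If the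
  fractions coincide, only the lower bound on the error of p'/q' helps, which is why that bound is
  assumed.\<close>

lemma rational_approximation_lower_bound:
  fixes \<xi> \<epsilon> b s x y :: real and p q p' q' :: int
  assumes b: "b \<ge> 2" and \<epsilon>: "0 < \<epsilon>" "\<epsilon> \<le> 1 / 20" and y: "y > 0"
    and q: "q > 0" "of_int q = b powr s" and q': "q' \<noteq> 0"
    and q'_le: "\<bar>of_int q'\<bar> \<le> b powr ((1 + \<epsilon>) * y)"
    and lo: "b powr (- (2 + 2 * \<epsilon>) * y) \<le> \<bar>\<xi> - of_int p' / of_int q'\<bar>"
    and hi: "\<bar>\<xi> - of_int p' / of_int q'\<bar> \<le> b powr (- (2 - \<epsilon>) * y)"
    and sy: "s + 1 \<le> (1 - 2 * \<epsilon>) * y"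
  shows "b powr (- (2 + 2 * \<epsilon>) * y) \<le> \<bar>\<xi> - of_int p / of_int q\<bar>"
proof (cases "real_of_int p / of_int q = of_int p' / of_int q'")
  case True
  then show ?thesis using lo by simp
next
  case False
  have "p * q' \<noteq> p' * q"
  proof
    assume "p * q' = p' * q"
    then have "real_of_int p * of_int q' = of_int p' * of_int q" by (simp only: of_int_mult[symmetric])
    then show False using False q(1) q' by (simp add: frac_eq_eq)
  qed
  then have "1 \<le> \<bar>p * q' - p' * q\<bar>" by linarith
  then have "1 \<le> \<bar>real_of_int (p * q' - p' * q)\<bar>" by (simp only: of_int_abs[symmetric] of_int_1_le_iff)
  then have "1 / (of_int q * \<bar>of_int q'\<bar>) \<le> \<bar>real_of_int (p * q' - p' * q)\<bar> / (of_int q * \<bar>of_int q'\<bar>)"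
    using q by (intro divide_right_mono) auto
  also have "\<dots> = \<bar>real_of_int p / of_int q - of_int p' / of_int q'\<bar>"
  proof -
    have "real_of_int p / of_int q - of_int p' / of_int q' = of_int (p * q' - p' * q) / (of_int q * of_int q')"
      using q(1) q' by (simp add: field_simps)
    then show ?thesis using q(1) by (simp add: abs_divide abs_mult)
  qed
  finally have sep: "1 / (of_int q * \<bar>of_int q'\<bar>) \<le> \<bar>real_of_int p / of_int q - of_int p' / of_int q'\<bar>" .
  define t where "t = s + (1 + \<epsilon>) * y"
  have "b powr (- t) = 1 / (b powr s * b powr ((1 + \<epsilon>) * y))"
    by (simp only: t_def powr_minus_divide powr_add)
  also have "\<dots> \<le> 1 / (of_int q * \<bar>of_int q'\<bar>)"
    using q q' q'_le b by (intro divide_left_mono mult_mono) (auto simp: q(2)[symmetric])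
  also note sep
  finally have 1: "b powr (- t) \<le> \<bar>real_of_int p / of_int q - of_int p' / of_int q'\<bar>" .
  \<comment> \<open>The coefficient 1 - 2 \<open>\<epsilon>\<close> of \<open>sy\<close> is (2 -
    \<open>\<epsilon>\<close>) - (1 + \<open>\<epsilon>\<close>), and the summand 1 yields a factor
    b >= 2, hence the half.\<close>
  have ty: "t + 1 \<le> (2 - \<epsilon>) * y" using sy by (simp add: t_def algebra_simps)
  have "b powr (- (2 - \<epsilon>) * y) \<le> b powr (- t - 1)"
    using ty b by (intro powr_mono) (auto simp: algebra_simps)
  also have "\<dots> = b powr (- t) / b" using b by (simp add: powr_diff)
  also have "\<dots> \<le> b powr (- t) / 2" using b by (intro divide_left_mono) auto
  finally have 2: "b powr (- (2 - \<epsilon>) * y) \<le> b powr (- t) / 2" .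
  have 3: "\<bar>real_of_int p / of_int q - of_int p' / of_int q'\<bar> \<le> \<bar>\<xi> - of_int p / of_int q\<bar> + \<bar>\<xi> - of_int p' / of_int q'\<bar>"
    by linarith
  have "- (2 + 2 * \<epsilon>) * y \<le> - (2 - \<epsilon>) * y" using \<epsilon> y by (intro mult_right_mono) auto
  then have "b powr (- (2 + 2 * \<epsilon>) * y) \<le> b powr (- (2 - \<epsilon>) * y)" using b by (intro powr_mono) auto
  then show ?thesis using 1 2 3 hi by linarith
qed

text \<open>A very good fraction with denominator b^s is compared with a known one at a scale y only
  slightly larger than s. The known one has error at least b^(-(2+2\<open>\<epsilon>\<close>)y),
  which excludes any exponent above 2 once s is large.\<close>

lemma finite_good_approximations:
  fixes \<xi> \<mu> :: real and n :: "nat \<Rightarrow> nat" and d b g :: nat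
  assumes d: "d \<ge> 2" and b: "b \<ge> 2" and mono: "strict_mono n" and n_pos: "\<And>i. n i > 0"
    and ratio: "(\<lambda>i. real (n (Suc i)) / real (n i)) \<longlonglongrightarrow> 1"
    and approx: "\<And>i. \<forall>\<^sub>F k in sequentially. \<exists>p q :: int. q \<noteq> 0 \<and> \<bar>real_of_int q\<bar> \<le> real (b ^ d ^ k) ^ (n i + g) \<and>
     1 / real (b ^ d ^ k) ^ (n i + n (Suc i) + g) \<le> \<bar>\<xi> - of_int p / of_int q\<bar> \<and>
     \<bar>\<xi> - of_int p / of_int q\<bar> \<le> real (b ^ d ^ k) ^ g / real (b ^ d ^ k) ^ (2 * n i)"
    and \<mu>: "\<mu> > 2"
  shows "finite {(p::int, q::int). q > 0 \<and> \<bar>\<xi> - real_of_int p / real_of_int q\<bar> < real_of_int q powr (- \<mu>)}"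
proof -
  define \<delta> where "\<delta> = min 1 (\<mu> - 2)"
  \<comment> \<open>Small enough for (2 + 2\<open>\<epsilon>\<close>)(1 + \<open>\<epsilon>\<close>)
    / (1 - 2\<open>\<epsilon>\<close>) to be at most 2 + \<open>\<delta>\<close>/2, as the last
    estimate requires.\<close>
  define \<epsilon> where "\<epsilon> = \<delta> / 20"
  have \<delta>: "0 < \<delta>" "\<delta> \<le> 1" "2 + \<delta> \<le> \<mu>" using \<mu> by (auto simp: \<delta>_def)
  have \<epsilon>: "0 < \<epsilon>" "\<epsilon> \<le> 1 / 20" "\<delta> = 20 * \<epsilon>" using \<delta> by (auto simp: \<epsilon>_def)
  have n_ge: "i \<le> n i" for i using mono by (rule strict_mono_imp_increasing)
  have "\<forall>\<^sub>F i in sequentially. real (n (Suc i)) / real (n i) < 1 + \<epsilon>"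
    using ratio by (rule order_tendstoD) (use \<epsilon> in simp)
  then obtain j0 where j0: "\<And>i. i \<ge> j0 \<Longrightarrow> real (n (Suc i)) / real (n i) < 1 + \<epsilon>"
    unfolding eventually_sequentially by blast
  \<comment> \<open>Because \<open>n i\<close> is at least \<open>i\<close>, the second bound makes
    the loss \<open>g\<close> at most \<open>\<epsilon> * n i\<close>.\<close>
  define i0 where "i0 = max j0 (nat \<lceil>real g / \<epsilon>\<rceil>)"
  have growth: "real (n (Suc i)) \<le> (1 + \<epsilon>) * real (n i)" if "i0 \<le> i" for i
    using j0[of i] that n_pos[of i] by (simp add: i0_def field_simps)
  have g_le: "real g \<le> \<epsilon> * real (n i)" if "i0 \<le> i" for i
  proof -
    have "real g / \<epsilon> \<le> real (nat \<lceil>real g / \<epsilon>\<rceil>)" by linarith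
    also have "\<dots> \<le> real (n i)" unfolding of_nat_le_iff using n_ge[of i] that by (simp add: i0_def)
    finally show ?thesis using \<epsilon> by (simp add: field_simps)
  qed
  define i1 where "i1 = max i0 (d * n i0)"
  have i1: "i0 \<le> i1" "d * n i0 \<le> n i1" using n_ge[of i1] by (auto simp: i1_def)
  define approx_at where "approx_at = (\<lambda>i k. \<exists>p q :: int. q \<noteq> 0 \<and> \<bar>real_of_int q\<bar> \<le> real (b ^ d ^ k) ^ (n i + g) \<and>
     1 / real (b ^ d ^ k) ^ (n i + n (Suc i) + g) \<le> \<bar>\<xi> - of_int p / of_int q\<bar> \<and>
     \<bar>\<xi> - of_int p / of_int q\<bar> \<le> real (b ^ d ^ k) ^ g / real (b ^ d ^ k) ^ (2 * n i))"
  have "\<forall>\<^sub>F k in sequentially. approx_at i k" for i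
    unfolding approx_at_def by (rule approx)
  then have "\<forall>\<^sub>F k in sequentially. \<forall>i\<in>{i0..i1}. approx_at i k"
    by (intro eventually_ball_finite) auto
  \<comment> \<open>A single threshold serves the whole window, because the window is
    finite.\<close>
  then obtain K where K: "\<And>k i. K \<le> k \<Longrightarrow> i \<in> {i0..i1} \<Longrightarrow> approx_at i k"
    unfolding eventually_sequentially by blast
  \<comment> \<open>The first bound is the value of s at which (2 + \<open>\<delta>\<close>) s
    reaches (2 + \<open>\<delta>\<close>/2)(s + 1); the second ensures that only exponents
    \<open>k\<close> beyond \<open>K\<close> are used.\<close>
  define s0 where "s0 = max ((4 + \<delta>) / \<delta>) (real (n i0 * d ^ K))"
  have b1: "real b > 1" using b by simp
  have key: "of_int q < real b powr s0"
    if q: "q > 0" and close: "\<bar>\<xi> - real_of_int p / real_of_int q\<bar> < real_of_int q powr (- \<mu>)" for p q :: int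
  proof (rule ccontr)
    assume "\<not> of_int q < real b powr s0"
    then have ge: "real b powr s0 \<le> of_int q" by simp
    define s where "s = log b (of_int q)"
    have qs: "of_int q = real b powr s" using q b1 by (simp add: s_def)
    have s: "s0 \<le> s" using ge b1 unfolding qs by simp
    have s_pos: "s > 0" using s \<delta> unfolding s0_def by (smt (verit) divide_pos_pos max.cobounded1)
    \<comment> \<open>Chosen so that x < (1 + \<open>\<epsilon>\<close>) y is precisely the
      separation condition s + 1 < (1 - 2\<open>\<epsilon>\<close>) y.\<close>
    define x where "x = (1 + \<epsilon>) * ((s + 1) / (1 - 2 * \<epsilon>))"
    have e2: "1 - 2 * \<epsilon> > 0" using \<epsilon> by simp
    have "s \<le> x"
    proof -
      have "s \<le> (s + 1) / (1 - 2 * \<epsilon>)" using e2 \<epsilon> s_pos by (simp add: field_simps)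
      also have "\<dots> = 1 * ((s + 1) / (1 - 2 * \<epsilon>))" by simp
      also have "\<dots> \<le> x" unfolding x_def using \<epsilon> e2 s_pos by (intro mult_right_mono) auto
      finally show ?thesis .
    qed
    then have "real (n i0 * d ^ K) \<le> x" using s by (simp add: s0_def)
    then obtain i k where ik: "i0 \<le> i" "i \<le> i1" "K \<le> k" and xy: "real (n i * d ^ k) \<le> x" "x < (1 + \<epsilon>) * real (n i * d ^ k)"
      using multiplicatively_dense[OF d growth i1 n_pos] by metis
    define y where "y = real (n i * d ^ k)"
    have y0: "y > 0" using n_pos[of i] d by (simp add: y_def)
    have "approx_at i k" using K ik by simp
    then obtain p' q' :: int where 1: "q' \<noteq> 0" "\<bar>real_of_int q'\<bar> \<le> real (b ^ d ^ k) ^ (n i + g)"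
       "1 / real (b ^ d ^ k) ^ (n i + n (Suc i) + g) \<le> \<bar>\<xi> - of_int p' / of_int q'\<bar>"
       "\<bar>\<xi> - of_int p' / of_int q'\<bar> \<le> real (b ^ d ^ k) ^ g / real (b ^ d ^ k) ^ (2 * n i)"
      unfolding approx_at_def by blast
    have pw: "real (b ^ d ^ k) ^ e = real b powr (real e * real (d ^ k))" for e
      using b1 by (simp add: powr_realpow[symmetric] powr_powr mult.commute)
    have ny: "real (n i) * real (d ^ k) = y" by (simp add: y_def)
    have "real (n i + g) * real (d ^ k) \<le> ((1 + \<epsilon>) * real (n i)) * real (d ^ k)"
      using g_le[OF ik(1)] by (intro mult_right_mono) (auto simp: algebra_simps)
    then have A: "\<bar>of_int q'\<bar> \<le> real b powr ((1 + \<epsilon>) * y)"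
      using 1(2) b1 unfolding pw ny[symmetric] by (elim order_trans) (intro powr_mono; simp add: mult.assoc)
    have "real (n i + n (Suc i) + g) * real (d ^ k) \<le> ((2 + 2 * \<epsilon>) * real (n i)) * real (d ^ k)"
      using g_le[OF ik(1)] growth[OF ik(1)] by (intro mult_right_mono) (auto simp: algebra_simps)
    then have "real (n i + n (Suc i) + g) * real (d ^ k) \<le> (2 + 2 * \<epsilon>) * y" by (simp only: mult.assoc ny)
    then have "- (2 + 2 * \<epsilon>) * y \<le> - (real (n i + n (Suc i) + g) * real (d ^ k))"
      unfolding mult_minus_left by (rule le_imp_neg_le)
    then have "real b powr (- (2 + 2 * \<epsilon>) * y) \<le> real b powr (- (real (n i + n (Suc i) + g) * real (d ^ k)))"
      using b1 by (intro powr_mono) simp_all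
    also have "\<dots> = 1 / real (b ^ d ^ k) ^ (n i + n (Suc i) + g)"
      unfolding pw by (simp add: powr_minus_divide)
    finally have B: "real b powr (- (2 + 2 * \<epsilon>) * y) \<le> \<bar>\<xi> - of_int p' / of_int q'\<bar>" using 1(3) by linarith
    have "(2 - \<epsilon>) * real (n i) * real (d ^ k) \<le> (real (2 * n i) - real g) * real (d ^ k)"
      using g_le[OF ik(1)] by (intro mult_right_mono) (auto simp: algebra_simps)
    then have "(2 - \<epsilon>) * y \<le> real (2 * n i) * real (d ^ k) - real g * real (d ^ k)"
      by (simp only: mult.assoc ny left_diff_distrib)
    then have "real g * real (d ^ k) - real (2 * n i) * real (d ^ k) \<le> - (2 - \<epsilon>) * y"
      unfolding mult_minus_left by linarith
    then have "real b powr (real g * real (d ^ k) - real (2 * n i) * real (d ^ k)) \<le> real b powr (- (2 - \<epsilon>) * y)"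
      using b1 by (intro powr_mono) simp_all
    moreover have "real (b ^ d ^ k) ^ g / real (b ^ d ^ k) ^ (2 * n i) = real b powr (real g * real (d ^ k) - real (2 * n i) * real (d ^ k))"
      unfolding pw by (simp add: powr_diff)
    ultimately have C: "\<bar>\<xi> - of_int p' / of_int q'\<bar> \<le> real b powr (- (2 - \<epsilon>) * y)" using 1(4) by linarith
    have sy: "s + 1 \<le> (1 - 2 * \<epsilon>) * y"
    proof -
      have "(1 + \<epsilon>) * ((s + 1) / (1 - 2 * \<epsilon>)) < (1 + \<epsilon>) * y" using xy(2) by (simp add: x_def y_def)
      then have "(s + 1) / (1 - 2 * \<epsilon>) < y" by (rule mult_left_less_imp_less) (use \<epsilon> in simp)
      then show ?thesis using e2 by (simp add: field_simps)
    qed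
    have "real b powr (- (2 + 2 * \<epsilon>) * y) \<le> \<bar>\<xi> - of_int p / of_int q\<bar>"
      by (rule rational_approximation_lower_bound[OF _ \<epsilon>(1,2) y0 q qs 1(1) A B C sy]) (use b in simp)
    also have "\<dots> < real b powr (- \<mu> * s)"
      using close unfolding qs by (simp add: powr_powr mult.commute)
    finally have "- (2 + 2 * \<epsilon>) * y < - \<mu> * s" using b1 by simp
    then have "\<mu> * s < (2 + 2 * \<epsilon>) * y" unfolding mult_minus_left neg_less_iff_less .
    also have "\<dots> \<le> (2 + 2 * \<epsilon>) * x" using xy(1) \<epsilon> by (intro mult_left_mono) (auto simp: y_def)
    also have "\<dots> = ((2 + 2 * \<epsilon>) * (1 + \<epsilon>) / (1 - 2 * \<epsilon>)) * (s + 1)" by (simp add: x_def)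
    also have "\<dots> \<le> (2 + \<delta> / 2) * (s + 1)"
    proof (rule mult_right_mono)
      have "\<epsilon> * \<epsilon> \<le> \<epsilon> * (1 / 20)" using \<epsilon> by (intro mult_left_mono) auto
      then have "(2 + 2 * \<epsilon>) * (1 + \<epsilon>) \<le> (2 + \<delta> / 2) * (1 - 2 * \<epsilon>)"
        using \<epsilon> by (simp add: algebra_simps)
      then show "(2 + 2 * \<epsilon>) * (1 + \<epsilon>) / (1 - 2 * \<epsilon>) \<le> 2 + \<delta> / 2" using e2 by (simp add: pos_divide_le_eq)
    qed (use s_pos in simp)
    finally have "(2 + \<delta>) * s < (2 + \<delta> / 2) * (s + 1)"
      using \<delta>(3) s_pos by (smt (verit) mult_right_mono)
    then have "s < (4 + \<delta>) / \<delta>" using \<delta> by (simp add: field_simps)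
    then show False using s by (simp add: s0_def)
  qed
  define Q where "Q = \<lceil>real b powr s0\<rceil>"
  define Z where "Z = \<lceil>(\<bar>\<xi>\<bar> + 1) * of_int Q\<rceil>"
  have "{(p::int, q::int). q > 0 \<and> \<bar>\<xi> - real_of_int p / real_of_int q\<bar> < real_of_int q powr (- \<mu>)} \<subseteq> {-Z..Z} \<times> {1..Q}"
  proof safe
    fix p q :: int assume q: "q > 0" and close: "\<bar>\<xi> - real_of_int p / real_of_int q\<bar> < real_of_int q powr (- \<mu>)"
    have qQ: "q \<le> Q" using key[OF q close] unfolding Q_def by linarith
    have "real_of_int q powr (- \<mu>) \<le> 1"
      using q \<mu> powr_mono[of "- \<mu>" 0 "real_of_int q"] by simp
    then have "\<bar>\<xi> - real_of_int p / real_of_int q\<bar> < 1" using close by linarith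
    then have "\<bar>real_of_int p / real_of_int q\<bar> < \<bar>\<xi>\<bar> + 1" by linarith
    then have "\<bar>real_of_int p\<bar> < (\<bar>\<xi>\<bar> + 1) * of_int q" using q by (simp add: abs_divide field_simps)
    also have "\<dots> \<le> (\<bar>\<xi>\<bar> + 1) * of_int Q" using qQ by (intro mult_left_mono) auto
    finally have "\<bar>p\<bar> \<le> Z" unfolding Z_def by linarith
    then show "p \<in> {-Z..Z}" "q \<in> {1..Q}" using q qQ by auto
  qed
  then show ?thesis by (rule finite_subset) simp
qed

text \<open>The lower bound is Dirichlet's theorem, in the form that an irrational number has an
  infinite \<open>approx_set\<close>.\<close>

lemma irrationality_exponent_eq_2:
  assumes irr: "\<xi> \<notin> \<rat>"
    and fin: "\<And>\<mu>. \<mu> > 2 \<Longrightarrow> finite {(p::int, q::int). q > 0 \<and>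
        \<bar>\<xi> - real_of_int p / real_of_int q\<bar> < real_of_int q powr (- \<mu>)}"
  shows "irrationality_exponent \<xi> = 2"
  unfolding irrationality_exponent_def
proof (rule antisym)
  show "Sup {ereal \<mu> | \<mu>. infinite {(p::int, q::int). q > 0 \<and>
            \<bar>\<xi> - real_of_int p / real_of_int q\<bar> < real_of_int q powr (- \<mu>)}} \<le> 2"
  proof (rule Sup_least, clarify)
    fix \<mu> assume "infinite {(p::int, q::int). q > 0 \<and>
            \<bar>\<xi> - real_of_int p / real_of_int q\<bar> < real_of_int q powr (- \<mu>)}"
    then have "\<mu> \<le> 2" using fin[of \<mu>] by (meson not_le)
    then have "ereal \<mu> \<le> ereal 2" by simp
    then show "ereal \<mu> \<le> 2" by (simp only: numeral_eq_ereal)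
  qed
  have "infinite (approx_set \<xi>)" using irr rational_iff_finite_approx_set by blast
  moreover have "approx_set \<xi> \<subseteq> {(p::int, q::int). q > 0 \<and>
            \<bar>\<xi> - real_of_int p / real_of_int q\<bar> < real_of_int q powr (- 2)}"
  proof (clarsimp simp: approx_set_def)
    fix p q :: int
    assume "0 < q" "\<bar>\<xi> - real_of_int p / real_of_int q\<bar> < 1 / (real_of_int q)\<^sup>2"
    then show "\<bar>\<xi> - real_of_int p / real_of_int q\<bar> < real_of_int q powr - 2"
      using powr_realpow[of "real_of_int q" 2] by (simp add: powr_minus_divide)
  qed
  ultimately have "infinite {(p::int, q::int). q > 0 \<and>
            \<bar>\<xi> - real_of_int p / real_of_int q\<bar> < real_of_int q powr (- 2)}"
    using infinite_super by blast
  then have "ereal 2 \<in> {ereal \<mu> | \<mu>. infinite {(p::int, q::int). q > 0 \<and>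
            \<bar>\<xi> - real_of_int p / real_of_int q\<bar> < real_of_int q powr (- \<mu>)}}" by blast
  then have "ereal 2 \<le> Sup {ereal \<mu> | \<mu>. infinite {(p::int, q::int). q > 0 \<and>
            \<bar>\<xi> - real_of_int p / real_of_int q\<bar> < real_of_int q powr (- \<mu>)}}" by (rule Sup_upper)
  then show "2 \<le> Sup {ereal \<mu> | \<mu>. infinite {(p::int, q::int). q > 0 \<and>
            \<bar>\<xi> - real_of_int p / real_of_int q\<bar> < real_of_int q powr (- \<mu>)}}" by simp
qed

section \<open>Proof of the theorem\<close>

lemma poly_of_int_of_real:
  "poly (map_poly of_int p) (complex_of_real x) = complex_of_real (poly (map_poly of_int p) x)"
  by (simp add: poly_altdef degree_map_poly coeff_map_poly)

theorem theorem2p1: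
  fixes d b :: nat and c :: "nat \<Rightarrow> int" and A B C :: "int poly" and n :: "nat \<Rightarrow> nat"
  assumes d: "d \<ge> 2"
    and conv: "\<And>z::complex. norm z < 1 \<Longrightarrow> summable (\<lambda>j. of_int (c j) * z ^ j)"
    and B: "B \<noteq> 0"
    and feq: "\<And>z::complex. norm z < 1 \<Longrightarrow> poly (map_poly of_int B) z \<noteq> 0 \<Longrightarrow>
               (\<Sum>j. of_int (c j) * z ^ j) =
                 poly (map_poly of_int A) z / poly (map_poly of_int B) z
                 + poly (map_poly of_int C) z * (\<Sum>j. of_int (c j) * (z ^ d) ^ j)"
    and b: "b \<ge> 2"
    and Cnz: "\<And>m::nat. poly (map_poly (of_int :: int \<Rightarrow> real) C) (1 / real b ^ (d ^ m)) \<noteq> 0"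
    and n_mono: "strict_mono n"
    and n_pos: "\<And>i. n i > 0"
    and hankel: "\<And>i. hankel_det c (n i) \<noteq> 0"
    and ratio: "(\<lambda>i. real (n (Suc i)) / real (n i)) \<longlonglongrightarrow> 1"
  shows "\<not> algebraic (\<Sum>j. real_of_int (c j) / real b ^ j)
         \<and> irrationality_exponent (\<Sum>j. real_of_int (c j) / real b ^ j) = 2"
proof -
  define \<xi> where "\<xi> = (\<Sum>j. real_of_int (c j) / real b ^ j)"
  define F where "F = (Abs_fps (\<lambda>n. of_int (c n)) :: complex fps)"
  define g where "g = eval_fps F"
  define N where "N = (\<lambda>k. b ^ (d ^ k))"
  have rad: "fps_conv_radius F \<ge> 1"
    unfolding fps_conv_radius_def F_def by (rule conv_radius_geI_ex') (simp add: conv)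
  have g: "g z = (\<Sum>j. of_int (c j) * z ^ j)" for z
    by (simp add: g_def eval_fps_def F_def)
  have cont: "isCont g z" if "norm z < 1" for z
    unfolding g_def using that rad by (intro continuous_eval_fps) (metis ereal_less(3) less_le_trans)
  have eqB: "poly (map_poly of_int B) z * g z =
      poly (map_poly of_int A) z + poly (map_poly of_int (B * C)) z * g (z ^ d)"
    if "norm z < 1" "poly (map_poly of_int B) z \<noteq> 0" for z
    unfolding g feq[OF that] using that(2) by (simp add: map_poly_of_int_mult field_simps)
  \<comment> \<open>The factor \<open>C\<close> is left unchanged, so the hypothesis on its values
    carries over to the reduced equation.\<close>
  obtain B' A' :: "int poly" where
    feq': "\<And>z. norm z < 1 \<Longrightarrow> poly (map_poly of_int B') z * g z =
       poly (map_poly of_int A') z + poly (map_poly of_int (B' * C)) z * g (z ^ d)"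
    and B'nz: "\<And>N::nat. N \<ge> 2 \<Longrightarrow> poly (map_poly of_int B') (1 / of_nat N :: complex) \<noteq> 0"
  proof (rule mahler_equation_no_zeros[OF d cont B eqB])
    fix A' B' :: "int poly"
    assume 1: "\<And>z. norm z < 1 \<Longrightarrow> poly (map_poly of_int B') z * g z =
       poly (map_poly of_int A') z + poly (map_poly of_int (B' * C)) z * g (z ^ d)"
      and 2: "\<And>N::nat. N \<ge> 2 \<Longrightarrow> poly (map_poly of_int B') (1 / of_nat N :: complex) \<noteq> 0"
    show thesis by (rule that[OF 1 2])
  qed
  have N_ge: "b \<le> N k" for k
    using b d power_increasing[of 1 "d ^ k" b] by (simp add: N_def)
  have B'nz': "poly (map_poly of_int B') (1 / of_nat (N k) :: complex) \<noteq> 0" for k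
    by (rule B'nz) (use N_ge[of k] b in linarith)
  have Cnz': "poly (map_poly of_int C) (1 / of_nat (N k) :: complex) \<noteq> 0" for k
    using Cnz[of k] poly_of_int_of_real[of C "1 / real (N k)"] by (simp add: N_def)
  obtain D u v :: "nat \<Rightarrow> int" and G :: nat where D0: "\<And>k. D k \<noteq> 0" and u0: "\<And>k. u k \<noteq> 0"
    and eq: "\<And>k. of_int (D k) * g (1 / of_nat (N k)) = of_int (u k) * g (1 / of_nat b) + of_int (v k)"
    and bd: "\<And>k. \<bar>D k\<bar> \<le> int (N k) ^ G" "\<And>k. \<bar>u k\<bar> \<le> int (N k) ^ G" "\<And>k. \<bar>v k\<bar> \<le> int (N k) ^ G"
  proof (rule mahler_iteration[OF d b N_def B'nz' Cnz' feq'])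
    fix D u v :: "nat \<Rightarrow> int" and G :: nat
    assume 1: "\<And>k. D k \<noteq> 0" "\<And>k. u k \<noteq> 0"
      "\<And>k. of_int (D k) * g (1 / of_nat (N k)) = of_int (u k) * g (1 / of_nat b) + of_int (v k)"
      "\<And>k. \<bar>D k\<bar> \<le> int (N k) ^ G" "\<And>k. \<bar>u k\<bar> \<le> int (N k) ^ G" "\<And>k. \<bar>v k\<bar> \<le> int (N k) ^ G"
    show thesis by (rule that[OF 1])
  qed
  have "g (1 / of_nat b) = complex_of_real \<xi>"
  proof -
    have "norm (1 / of_nat b :: complex) < 1" using b by (simp add: norm_divide)
    from conv[OF this] have "summable (\<lambda>j. complex_of_real (real_of_int (c j) / real b ^ j))"
      by (simp add: divide_inverse power_inverse)
    then have "summable (\<lambda>j. real_of_int (c j) / real b ^ j)" by (simp only: summable_complex_of_real)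
    from suminf_of_real[OF this, where 'a = complex] show ?thesis
      by (simp add: g \<xi>_def divide_inverse power_inverse)
  qed
  note eq = eq[unfolded this, unfolded g_def F_def]
  have N_lim: "filterlim N at_top sequentially"
  proof (rule filterlim_at_top_mono[OF filterlim_ident], intro always_eventually allI)
    fix k
    have "k < 2 ^ k" by (rule less_exp)
    also have "(2 :: nat) ^ k \<le> d ^ k" using d by (rule power_mono) simp
    also have "d ^ k < 2 ^ (d ^ k)" by (rule less_exp)
    also have "(2 :: nat) ^ (d ^ k) \<le> N k" unfolding N_def using b by (rule power_mono) simp
    finally show "k \<le> N k" by simp
  qed
  note rad = rad[unfolded F_def]
  have trans: "\<not> algebraic \<xi>"
    by (rule mahler_transcendence[OF rad hankel_infinite_support[OF n_mono hankel] N_lim D0 eq bd])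
  moreover have "irrationality_exponent \<xi> = 2"
  proof (rule irrationality_exponent_eq_2)
    show "\<xi> \<notin> \<rat>" using trans rat_imp_algebraic by blast
    fix \<mu> :: real assume "\<mu> > 2"
    show "finite {(p::int, q::int). q > 0 \<and> \<bar>\<xi> - real_of_int p / real_of_int q\<bar> < real_of_int q powr (- \<mu>)}"
      by (rule finite_good_approximations[OF d b n_mono n_pos ratio _ \<open>\<mu> > 2\<close>],
          rule hankel_approximants[OF rad N_lim D0 u0 eq bd(1,2) hankel hankel, unfolded N_def],
          rule strict_monoD[OF n_mono], rule lessI)
  qed
  ultimately show ?thesis unfolding \<xi>_def ..
qed

end
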